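(* Let $\Gamma$ be a nontrivial additive subgroup of $\mathbb{C}$ and $HV=HV(\Gamma)$. The derivation space of $HV$ can be written as $$\mathrm{Der}\,HV=\bigoplus_{\gamma\in\Gamma}(\mathrm{Der}\,HV)_\gamma=\mathrm{ad}\,HV\oplus\mathrm{Hom}_{\mathbb{Z}}(\Gamma,\mathbb{C})\oplus\mathbb{C}D_1\oplus\mathbb{C}D_2,$$ where $(\mathrm{Der}\,HV)_\gamma\subset\mathrm{ad}\,HV$ if $\gamma\in\Gamma\setminus\{0\}$, and $$(\mathrm{Der}\,HV)_0=(\mathrm{ad}\,HV)_0\oplus\mathrm{Hom}_{\mathbb{Z}}(\Gamma,\mathbb{C})\oplus\mathbb{C}D_1\oplus\mathbb{C}D_2.$$
   Context: $\mathbb{Z}_+$ denotes the nonnegative integers. For a nontrivial additive subgroup $\Gamma$ of $\mathbb{C}$, $HV=HV(\Gamma)$ is the complex Lie algebra with basis $\{L_{\alpha,i},H_{\alpha,i}\mid\alpha\in\Gamma,\ i\in\mathbb{Z}_+\}$ and brackets $$[L_{\alpha,i},L_{\beta,j}]=(\beta-\alpha)L_{\alpha+\beta,i+j}+(j-i)L_{\alpha+\beta,i+j-1},$$ $$[L_{\alpha,i},H_{\beta,j}]=\beta H_{\alpha+\beta,i+j}+jH_{\alpha+\beta,i+j-1},\qquad [H_{\alpha,i},H_{\beta,j}]=0,$$ where terms with second index $-1$ have coefficient $0$ and are read as $0$. It is $\Gamma$-graded by $HV_\alpha=\mathrm{span}\{L_{\alpha,i},H_{\alpha,i}\mid i\in\mathbb{Z}_+\}$.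 $\mathrm{Der}\,HV$ is the space of ($\mathbb{C}$-linear) derivations of $HV$, $\mathrm{ad}\,HV$ the space of inner derivations $\mathrm{ad}_z$, $z\in HV$. A derivation $D$ has degree $\gamma\in\Gamma$ if $D(HV_\alpha)\subset HV_{\alpha+\gamma}$ for all $\alpha\in\Gamma$; $(\mathrm{Der}\,HV)_\gamma$ is the space of derivations of degree $\gamma$, and $(\mathrm{ad}\,HV)_0=\mathrm{ad}\,HV\cap(\mathrm{Der}\,HV)_0$. $\mathrm{Hom}_{\mathbb{Z}}(\Gamma,\mathbb{C})$ is the complex vector space of group homomorphisms $\Gamma\to\mathbb{C}$; it is identified with a subspace of $\mathrm{Der}\,HV$ via $\phi\mapsto D_\phi$, where $D_\phi(L_{\alpha,i})=\phi(\alpha)L_{\alpha,i}$, $D_\phi(H_{\alpha,i})=\phi(\alpha)H_{\alpha,i}$. $D_1,D_2$ are the derivations of degree $0$ given, for $\alpha\in\Gamma$, $i\in\mathbb{Z}_+$, by $D_1(L_{\alpha,i})=\alpha H_{\alpha,i}+iH_{\alpha,i-1}$, $D_1(H_{\alpha,i})=0$, and $D_2(L_{\alpha,i})=0$, $D_2(H_{\alpha,i})=H_{\alpha,i}$. *)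

theory Defs
  imports Complex_Main "HOL-Library.Poly_Mapping" "HOL-Library.Function_Algebras"
begin

section \<open>The Lie algebra \<open>HV(\<Gamma>)\<close>\<close>

datatype hv_index = LI complex nat | HI complex nat

text \<open>\<open>hv\<close> is the complex vector space with basis \<open>L \<alpha> i\<close>, \<open>H \<alpha> i\<close> for all complex \<open>\<alpha>\<close>;
  \<open>HV \<Gamma>\<close> is its subspace spanned by the basis vectors with \<open>\<alpha> \<in> \<Gamma>\<close>.  The bracket formulas
  do not depend on \<open>\<Gamma>\<close>, so they are given once on \<open>hv\<close>, and the bracket of \<open>HV \<Gamma>\<close> is the
  restriction.\<close>

type_synonym hv = "hv_index \<Rightarrow>\<^sub>0 complex"

definition hv_scale :: "complex \<Rightarrow> hv \<Rightarrow> hv" (infixr \<open>*\<^sub>h\<close> 75)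
  where "c *\<^sub>h x = Poly_Mapping.map ((*) c) x"

lemma lookup_hv_scale [simp]: "Poly_Mapping.lookup (c *\<^sub>h x) b = c * Poly_Mapping.lookup x b"
  by (simp add: hv_scale_def map.rep_eq when_def)

interpretation hv: vector_space hv_scale
  by unfold_locales (auto intro!: poly_mapping_eqI simp: lookup_add algebra_simps)

definition L :: "complex \<Rightarrow> nat \<Rightarrow> hv"
  where "L \<alpha> i = Poly_Mapping.single (LI \<alpha> i) 1"

definition H :: "complex \<Rightarrow> nat \<Rightarrow> hv"
  where "H \<alpha> i = Poly_Mapping.single (HI \<alpha> i) 1"

text \<open>Truncated subtraction in the second index is harmless: whenever \<open>i + j - 1\<close> (or \<open>i - 1\<close>
  in \<open>D1_basis\<close> below) is truncated, the coefficient in front is \<open>0\<close>.\<close>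

fun bracket_basis :: "hv_index \<Rightarrow> hv_index \<Rightarrow> hv" where
  "bracket_basis (LI \<alpha> i) (LI \<beta> j) =
     (\<beta> - \<alpha>) *\<^sub>h L (\<alpha> + \<beta>) (i + j) + (of_nat j - of_nat i) *\<^sub>h L (\<alpha> + \<beta>) (i + j - 1)"
| "bracket_basis (LI \<alpha> i) (HI \<beta> j) =
     \<beta> *\<^sub>h H (\<alpha> + \<beta>) (i + j) + of_nat j *\<^sub>h H (\<alpha> + \<beta>) (i + j - 1)"
| "bracket_basis (HI \<alpha> i) (LI \<beta> j) =
     - (\<alpha> *\<^sub>h H (\<beta> + \<alpha>) (j + i) + of_nat i *\<^sub>h H (\<beta> + \<alpha>) (j + i - 1))"
| "bracket_basis (HI \<alpha> i) (HI \<beta> j) = 0"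

definition bracket :: "hv \<Rightarrow> hv \<Rightarrow> hv"
  where "bracket x y =
    (\<Sum>a\<in>Poly_Mapping.keys x. \<Sum>b\<in>Poly_Mapping.keys y.
      (Poly_Mapping.lookup x a * Poly_Mapping.lookup y b) *\<^sub>h bracket_basis a b)"

definition HV :: "complex set \<Rightarrow> hv set"
  where "HV \<Gamma> = {x. Poly_Mapping.keys x \<subseteq> (\<Union>\<alpha>\<in>\<Gamma>. range (LI \<alpha>) \<union> range (HI \<alpha>))}"

definition HV_comp :: "complex \<Rightarrow> hv set"
  where "HV_comp \<alpha> = hv.span (range (L \<alpha>) \<union> range (H \<alpha>))"


section \<open>Derivations\<close>

text \<open>A map \<open>HV \<Gamma> \<rightarrow> HV \<Gamma>\<close> is represented by the function on all of \<open>hv\<close> that agrees with it on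
  \<open>HV \<Gamma>\<close> and vanishes outside; equality and the pointwise vector space operations on such
  functions are then those of maps on \<open>HV \<Gamma>\<close>.\<close>

definition map_scale :: "complex \<Rightarrow> (hv \<Rightarrow> hv) \<Rightarrow> hv \<Rightarrow> hv"
  where "map_scale c D = (\<lambda>x. c *\<^sub>h D x)"

interpretation maps: vector_space map_scale
  by unfold_locales
    (auto simp: map_scale_def fun_eq_iff hv.scale_right_distrib hv.scale_left_distrib)

definition Der :: "complex set \<Rightarrow> (hv \<Rightarrow> hv) set"
  where "Der \<Gamma> = {D.
    (\<forall>x\<in>HV \<Gamma>. D x \<in> HV \<Gamma>) \<and> (\<forall>x. x \<notin> HV \<Gamma> \<longrightarrow> D x = 0) \<and>
    (\<forall>x\<in>HV \<Gamma>. \<forall>y\<in>HV \<Gamma>. D (x + y) = D x + D y) \<and>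
    (\<forall>c. \<forall>x\<in>HV \<Gamma>. D (c *\<^sub>h x) = c *\<^sub>h D x) \<and>
    (\<forall>x\<in>HV \<Gamma>. \<forall>y\<in>HV \<Gamma>. D (bracket x y) = bracket (D x) y + bracket x (D y))}"

definition Der_deg :: "complex set \<Rightarrow> complex \<Rightarrow> (hv \<Rightarrow> hv) set"
  where "Der_deg \<Gamma> \<gamma> = {D \<in> Der \<Gamma>. \<forall>\<alpha>\<in>\<Gamma>. D ` HV_comp \<alpha> \<subseteq> HV_comp (\<alpha> + \<gamma>)}"

definition ad :: "complex set \<Rightarrow> hv \<Rightarrow> hv \<Rightarrow> hv"
  where "ad \<Gamma> z = (\<lambda>x. if x \<in> HV \<Gamma> then bracket z x else 0)"

definition adHV :: "complex set \<Rightarrow> (hv \<Rightarrow> hv) set"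
  where "adHV \<Gamma> = ad \<Gamma> ` HV \<Gamma>"

text \<open>The linear map on \<open>HV \<Gamma>\<close> with prescribed values on the basis.\<close>

definition lin_ext :: "complex set \<Rightarrow> (hv_index \<Rightarrow> hv) \<Rightarrow> hv \<Rightarrow> hv"
  where "lin_ext \<Gamma> f = (\<lambda>x. if x \<in> HV \<Gamma> then
    \<Sum>b\<in>Poly_Mapping.keys x. Poly_Mapping.lookup x b *\<^sub>h f b else 0)"

text \<open>As for maps on \<open>HV \<Gamma>\<close>, homomorphisms \<open>\<Gamma> \<rightarrow> \<complex>\<close> are extended by zero.\<close>

definition Hom_Z :: "complex set \<Rightarrow> (complex \<Rightarrow> complex) set"
  where "Hom_Z \<Gamma> = {\<phi>. (\<forall>\<alpha>\<in>\<Gamma>. \<forall>\<beta>\<in>\<Gamma>. \<phi> (\<alpha> + \<beta>) = \<phi> \<alpha> + \<phi> \<beta>) \<and> (\<forall>\<alpha>. \<alpha> \<notin> \<Gamma> \<longrightarrow> \<phi> \<alpha> = 0)}"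

fun Dphi_basis :: "(complex \<Rightarrow> complex) \<Rightarrow> hv_index \<Rightarrow> hv" where
  "Dphi_basis \<phi> (LI \<alpha> i) = \<phi> \<alpha> *\<^sub>h L \<alpha> i"
| "Dphi_basis \<phi> (HI \<alpha> i) = \<phi> \<alpha> *\<^sub>h H \<alpha> i"

definition Dphi :: "complex set \<Rightarrow> (complex \<Rightarrow> complex) \<Rightarrow> hv \<Rightarrow> hv"
  where "Dphi \<Gamma> \<phi> = lin_ext \<Gamma> (Dphi_basis \<phi>)"

fun D1_basis :: "hv_index \<Rightarrow> hv" where
  "D1_basis (LI \<alpha> i) = \<alpha> *\<^sub>h H \<alpha> i + of_nat i *\<^sub>h H \<alpha> (i - 1)"
| "D1_basis (HI \<alpha> i) = 0"

definition D1 :: "complex set \<Rightarrow> hv \<Rightarrow> hv"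
  where "D1 \<Gamma> = lin_ext \<Gamma> D1_basis"

fun D2_basis :: "hv_index \<Rightarrow> hv" where
  "D2_basis (LI \<alpha> i) = 0"
| "D2_basis (HI \<alpha> i) = H \<alpha> i"

definition D2 :: "complex set \<Rightarrow> hv \<Rightarrow> hv"
  where "D2 \<Gamma> = lin_ext \<Gamma> D2_basis"

lemma inj_on_Dphi: "inj_on (Dphi \<Gamma>) (Hom_Z \<Gamma>)"
proof (rule inj_onI)
  fix \<phi> \<psi> assume hom: "\<phi> \<in> Hom_Z \<Gamma>" "\<psi> \<in> Hom_Z \<Gamma>" and eq: "Dphi \<Gamma> \<phi> = Dphi \<Gamma> \<psi>"
  have val: "Poly_Mapping.lookup (Dphi \<Gamma> \<chi> (L \<alpha> 0)) (LI \<alpha> 0) = \<chi> \<alpha>" if "\<alpha> \<in> \<Gamma>" for \<chi> \<alpha>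
    using that by (auto simp: Dphi_def lin_ext_def HV_def L_def)
  show "\<phi> = \<psi>"
  proof
    fix \<alpha> show "\<phi> \<alpha> = \<psi> \<alpha>"
      using hom val[of \<alpha> \<phi>] val[of \<alpha> \<psi>] eq by (cases "\<alpha> \<in> \<Gamma>") (auto simp: Hom_Z_def)
  qed
qed


section \<open>Internal direct sums\<close>

text \<open>\<open>V\<close> is the internal direct sum of the subspaces \<open>W i\<close>, \<open>i \<in> I\<close>: summation is a bijection
  onto \<open>V\<close> from the finitely supported families with \<open>i\<close>-th entry in \<open>W i\<close>.\<close>

definition is_direct_sum :: "(hv \<Rightarrow> hv) set \<Rightarrow> 'i set \<Rightarrow> ('i \<Rightarrow> (hv \<Rightarrow> hv) set) \<Rightarrow> bool"
  where "is_direct_sum V I W \<longleftrightarrow>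
    (\<forall>i\<in>I. maps.subspace (W i)) \<and>
    bij_betw (\<lambda>f. \<Sum>i\<in>{i. f i \<noteq> 0}. f i)
      {f. (\<forall>i\<in>I. f i \<in> W i) \<and> (\<forall>i. i \<notin> I \<longrightarrow> f i = 0) \<and> finite {i. f i \<noteq> 0}} V"

definition is_direct_sum_list :: "(hv \<Rightarrow> hv) set \<Rightarrow> (hv \<Rightarrow> hv) set list \<Rightarrow> bool"
  where "is_direct_sum_list V Ws \<longleftrightarrow> is_direct_sum V {..<length Ws} (\<lambda>i. Ws ! i)"

end

theory Submission
  imports Defs
begin

text \<open>The operator \<open>ad (L 0 0)\<close> acts on degree \<open>\<alpha>\<close> as \<open>\<alpha> + d/dt\<close>, writing \<open>t^i\<close> for the
  second index \<open>i\<close>; it is surjective on \<open>HV \<Gamma>\<close>, with generalised eigenspaces the homogeneous components and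
  proper \<open>\<alpha>\<close>-eigenspace spanned by \<open>L \<alpha> 0\<close> and \<open>H \<alpha> 0\<close>.  Surjectivity allows one to subtract an
  inner derivation from any \<open>D\<close> so that \<open>D (L 0 0) = 0\<close>.  Then \<open>D\<close> commutes with \<open>ad (L 0 0)\<close>,
  so its values on \<open>L 0 1\<close>, \<open>L \<alpha> 0\<close>, \<open>H 0 0\<close> and \<open>H 0 1\<close> are known up to two scalars each;
  after subtracting multiples of \<open>ad (L 0 0)\<close> and \<open>D1\<close> the brackets with \<open>L 0 n\<close> force
  \<open>D (L \<alpha> n) = \<phi> \<alpha> *\<^sub>h L \<alpha> n\<close> with \<open>\<phi>\<close> additive, and what remains on the \<open>H\<close>-part is a multiple
  of \<open>D2\<close>.\<close>

section \<open>Bases and brackets\<close>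

text \<open>Degree of a basis vector in the grading. Forgetting the letter and the second index
  turns membership in \<open>HV \<Gamma>\<close> into a single condition on the support.\<close>

fun bdeg :: "hv_index \<Rightarrow> complex" where
  "bdeg (LI \<alpha> i) = \<alpha>"
| "bdeg (HI \<alpha> i) = \<alpha>"

abbreviation basis :: "hv_index \<Rightarrow> hv"
  where "basis b \<equiv> Poly_Mapping.single b 1"

lemma LI_basis: "basis (LI \<alpha> i) = L \<alpha> i" and HI_basis: "basis (HI \<alpha> i) = H \<alpha> i"
  by (simp_all add: L_def H_def)

lemma lookup_L_LI [simp]: "Poly_Mapping.lookup (L \<alpha> i) (LI \<beta> j) = (if \<alpha> = \<beta> \<and> i = j then 1 else 0)"
  and lookup_L_HI [simp]: "Poly_Mapping.lookup (L \<alpha> i) (HI \<beta> j) = 0"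
  and lookup_H_HI [simp]: "Poly_Mapping.lookup (H \<alpha> i) (HI \<beta> j) = (if \<alpha> = \<beta> \<and> i = j then 1 else 0)"
  and lookup_H_LI [simp]: "Poly_Mapping.lookup (H \<alpha> i) (LI \<beta> j) = 0"
  by (auto simp: L_def H_def lookup_single when_def)

lemma hv_eqI:
  assumes "\<And>\<alpha> i. Poly_Mapping.lookup x (LI \<alpha> i) = Poly_Mapping.lookup y (LI \<alpha> i)"
    and "\<And>\<alpha> i. Poly_Mapping.lookup x (HI \<alpha> i) = Poly_Mapping.lookup y (HI \<alpha> i)"
  shows "(x :: hv) = y"
proof (rule poly_mapping_eqI)
  show "Poly_Mapping.lookup x b = Poly_Mapping.lookup y b" for b
    using assms by (cases b) auto
qed

lemma hv_expansion:
  assumes "finite S" "Poly_Mapping.keys x \<subseteq> S"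
  shows "x = (\<Sum>b\<in>S. Poly_Mapping.lookup x b *\<^sub>h basis b)"
proof (rule poly_mapping_eqI)
  fix c
  have "Poly_Mapping.lookup (\<Sum>b\<in>S. Poly_Mapping.lookup x b *\<^sub>h basis b) c
      = (\<Sum>b\<in>S. if b = c then Poly_Mapping.lookup x c else 0)"
    by (auto simp: lookup_sum lookup_single when_def intro!: sum.cong)
  also have "\<dots> = Poly_Mapping.lookup x c"
    using assms by (auto simp: in_keys_iff)
  finally show "Poly_Mapping.lookup x c
      = Poly_Mapping.lookup (\<Sum>b\<in>S. Poly_Mapping.lookup x b *\<^sub>h basis b) c" ..
qed

lemma HV_iff: "x \<in> HV \<Gamma> \<longleftrightarrow> bdeg ` Poly_Mapping.keys x \<subseteq> \<Gamma>"
proof -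
  have "b \<in> (\<Union>\<alpha>\<in>\<Gamma>. range (LI \<alpha>) \<union> range (HI \<alpha>)) \<longleftrightarrow> bdeg b \<in> \<Gamma>" for b
    by (cases b) auto
  then show ?thesis unfolding HV_def by blast
qed

lemma subspace_HV: "hv.subspace (HV \<Gamma>)"
proof -
  have "x \<in> HV \<Gamma> \<longleftrightarrow> (\<forall>b. bdeg b \<notin> \<Gamma> \<longrightarrow> Poly_Mapping.lookup x b = 0)" for x
    unfolding HV_iff image_subset_iff by (auto simp: in_keys_iff)
  then show ?thesis
    by (auto simp: hv.subspace_def lookup_add)
qed

lemmas HV_zero [simp] = hv.subspace_0[OF subspace_HV]
  and HV_add [simp] = hv.subspace_add[OF subspace_HV]
  and HV_scale [simp] = hv.subspace_scale[OF subspace_HV]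
  and HV_diff [simp] = hv.subspace_diff[OF subspace_HV]
  and HV_minus [simp] = hv.subspace_neg[OF subspace_HV]
  and HV_sum = hv.subspace_sum[OF subspace_HV]

lemma basis_in_HV [simp]: "basis b \<in> HV \<Gamma> \<longleftrightarrow> bdeg b \<in> \<Gamma>"
  by (simp add: HV_iff)

lemma L_in_HV [simp]: "L \<alpha> i \<in> HV \<Gamma> \<longleftrightarrow> \<alpha> \<in> \<Gamma>"
  and H_in_HV [simp]: "H \<alpha> i \<in> HV \<Gamma> \<longleftrightarrow> \<alpha> \<in> \<Gamma>"
  by (simp_all flip: LI_basis HI_basis)

lemma HV_eq_span: "HV \<Gamma> = hv.span (basis ` {b. bdeg b \<in> \<Gamma>})"
proof
  show "HV \<Gamma> \<subseteq> hv.span (basis ` {b. bdeg b \<in> \<Gamma>})"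
  proof
    fix x assume "x \<in> HV \<Gamma>"
    then have "(\<Sum>b\<in>Poly_Mapping.keys x. Poly_Mapping.lookup x b *\<^sub>h basis b)
        \<in> hv.span (basis ` {b. bdeg b \<in> \<Gamma>})"
      by (intro hv.span_sum hv.span_scale hv.span_base) (auto simp: HV_iff)
    then show "x \<in> hv.span (basis ` {b. bdeg b \<in> \<Gamma>})"
      using hv_expansion[OF finite_keys subset_refl, of x] by simp
  qed
  show "hv.span (basis ` {b. bdeg b \<in> \<Gamma>}) \<subseteq> HV \<Gamma>"
    by (rule hv.span_minimal[OF _ subspace_HV]) auto
qed

text \<open>\<open>HV\<close> makes sense for any set of degrees, so a homogeneous component is the
  case of a singleton, and closure and induction for \<open>HV\<close> apply to components as
  well.\<close>

lemma HV_comp_eq: "HV_comp \<alpha> = HV {\<alpha>}"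
proof -
  have "b \<in> range (LI \<alpha>) \<union> range (HI \<alpha>)" if "bdeg b = \<alpha>" for b
    using that by (cases b) auto
  then have "{b. bdeg b = \<alpha>} = range (LI \<alpha>) \<union> range (HI \<alpha>)" by auto
  then have "basis ` {b. bdeg b \<in> {\<alpha>}} = range (L \<alpha>) \<union> range (H \<alpha>)"
    by (simp add: image_Un image_image LI_basis HI_basis)
  then show ?thesis by (simp add: HV_comp_def HV_eq_span)
qed

text \<open>Linear claims reduce to basis vectors, added one scaled vector at a time. With
  \<open>UNIV\<close> for \<open>\<Gamma>\<close> this is induction over all of
  \<open>hv\<close>.\<close>

lemma HV_induct [consumes 1, case_names zero step]:
  assumes "x \<in> HV \<Gamma>" "P 0"
    and step: "\<And>c b y. bdeg b \<in> \<Gamma> \<Longrightarrow> y \<in> HV \<Gamma> \<Longrightarrow> P y \<Longrightarrow> P (c *\<^sub>h basis b + y)"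
  shows "P x"
proof -
  have "x \<in> hv.span (basis ` {b. bdeg b \<in> \<Gamma>})" using assms(1) by (simp add: HV_eq_span)
  then have "x \<in> HV \<Gamma> \<and> P x"
    by (induction rule: hv.span_induct_alt) (auto simp: \<open>P 0\<close> step)
  then show ?thesis ..
qed

lemma HV_UNIV [simp]: "x \<in> HV UNIV"
  by (simp add: HV_iff)

section \<open>Bilinearity and homogeneity of the bracket\<close>

text \<open>The extra terms have coefficient zero. Two vectors and their sum, whose support can
  shrink by cancellation, are thereby expanded over one common index set, and bilinearity becomes a
  termwise identity.\<close>

lemma bracket_superset:
  assumes "finite A" "Poly_Mapping.keys x \<subseteq> A" "finite B" "Poly_Mapping.keys y \<subseteq> B"
  shows "bracket x y = (\<Sum>a\<in>A. \<Sum>b\<in>B.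
    (Poly_Mapping.lookup x a * Poly_Mapping.lookup y b) *\<^sub>h bracket_basis a b)"
proof -
  have "bracket x y = (\<Sum>a\<in>Poly_Mapping.keys x. \<Sum>b\<in>B.
      (Poly_Mapping.lookup x a * Poly_Mapping.lookup y b) *\<^sub>h bracket_basis a b)"
    unfolding bracket_def
    by (intro sum.cong refl sum.mono_neutral_left) (use assms in \<open>auto simp: in_keys_iff\<close>)
  also have "\<dots> = (\<Sum>a\<in>A. \<Sum>b\<in>B.
      (Poly_Mapping.lookup x a * Poly_Mapping.lookup y b) *\<^sub>h bracket_basis a b)"
    by (intro sum.mono_neutral_left) (use assms in \<open>auto simp: in_keys_iff\<close>)
  finally show ?thesis .
qed

lemma bracket_add_left [simp]: "bracket (x + x') y = bracket x y + bracket x' y"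
proof -
  let ?A = "Poly_Mapping.keys x \<union> Poly_Mapping.keys x'" and ?B = "Poly_Mapping.keys y"
  have "Poly_Mapping.keys (x + x') \<subseteq> ?A" by (rule Poly_Mapping.keys_add)
  then show ?thesis
    by (simp add: bracket_superset[of ?A _ ?B] lookup_add distrib_right hv.scale_left_distrib
        sum.distrib)
qed

lemma bracket_add_right [simp]: "bracket x (y + y') = bracket x y + bracket x y'"
proof -
  let ?A = "Poly_Mapping.keys x" and ?B = "Poly_Mapping.keys y \<union> Poly_Mapping.keys y'"
  have "Poly_Mapping.keys (y + y') \<subseteq> ?B" by (rule Poly_Mapping.keys_add)
  then show ?thesis
    by (simp add: bracket_superset[of ?A _ ?B] lookup_add distrib_left hv.scale_left_distrib
        sum.distrib)
qed

lemma keys_hv_scale: "Poly_Mapping.keys (c *\<^sub>h x) \<subseteq> Poly_Mapping.keys x"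
  by (auto simp: in_keys_iff)

lemma bracket_scale_left [simp]: "bracket (c *\<^sub>h x) y = c *\<^sub>h bracket x y"
  using keys_hv_scale[of c x]
  by (simp add: bracket_superset[of "Poly_Mapping.keys x" _ "Poly_Mapping.keys y"]
      hv.scale_sum_right mult.assoc)

lemma bracket_scale_right [simp]: "bracket x (c *\<^sub>h y) = c *\<^sub>h bracket x y"
  using keys_hv_scale[of c y]
  by (simp add: bracket_superset[of "Poly_Mapping.keys x" _ "Poly_Mapping.keys y"]
      hv.scale_sum_right mult_ac)

lemma bracket_zero_left [simp]: "bracket 0 y = 0"
  and bracket_zero_right [simp]: "bracket x 0 = 0"
  by (simp_all add: bracket_def)

lemma bracket_minus_left [simp]: "bracket (- x) y = - bracket x y"
  using bracket_add_left[of x "-x" y] by (simp add: eq_neg_iff_add_eq_0 add.commute)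

lemma bracket_minus_right [simp]: "bracket x (- y) = - bracket x y"
  using bracket_add_right[of x y "-y"] by (simp add: eq_neg_iff_add_eq_0 add.commute)

lemma bracket_diff_left [simp]: "bracket (x - x') y = bracket x y - bracket x' y"
  using bracket_add_left[of x "- x'" y] by simp

lemma bracket_diff_right [simp]: "bracket x (y - y') = bracket x y - bracket x y'"
  using bracket_add_right[of x y "- y'"] by simp

lemma bracket_basis_basis [simp]: "bracket (basis a) (basis b) = bracket_basis a b"
  by (simp add: bracket_def)

lemma bracket_L_L [simp]: "bracket (L \<alpha> i) (L \<beta> j) =
     (\<beta> - \<alpha>) *\<^sub>h L (\<alpha> + \<beta>) (i + j) + (of_nat j - of_nat i) *\<^sub>h L (\<alpha> + \<beta>) (i + j - 1)"
  and bracket_L_H [simp]: "bracket (L \<alpha> i) (H \<beta> j) =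
     \<beta> *\<^sub>h H (\<alpha> + \<beta>) (i + j) + of_nat j *\<^sub>h H (\<alpha> + \<beta>) (i + j - 1)"
  and bracket_H_L [simp]: "bracket (H \<alpha> i) (L \<beta> j) =
     - (\<alpha> *\<^sub>h H (\<beta> + \<alpha>) (j + i) + of_nat i *\<^sub>h H (\<beta> + \<alpha>) (j + i - 1))"
  and bracket_H_H [simp]: "bracket (H \<alpha> i) (H \<beta> j) = 0"
  using bracket_basis_basis[of "LI \<alpha> i" "LI \<beta> j"] bracket_basis_basis[of "LI \<alpha> i" "HI \<beta> j"]
    bracket_basis_basis[of "HI \<alpha> i" "LI \<beta> j"] bracket_basis_basis[of "HI \<alpha> i" "HI \<beta> j"]
  by (simp_all only: LI_basis HI_basis bracket_basis.simps)

text \<open>Three separate sets of degrees serve two purposes: closure of \<open>HV \<Gamma>\<close>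
  under the bracket and, with singletons, additivity of degrees.\<close>

lemma bracket_HV:
  assumes "x \<in> HV A" "y \<in> HV B" "\<And>\<alpha> \<beta>. \<alpha> \<in> A \<Longrightarrow> \<beta> \<in> B \<Longrightarrow> \<alpha> + \<beta> \<in> C"
  shows "bracket x y \<in> HV C"
proof -
  have "bracket_basis a b \<in> HV C" if "bdeg a \<in> A" "bdeg b \<in> B" for a b
    using that assms(3)[of "bdeg a" "bdeg b"] by (cases a; cases b) (auto simp: add.commute)
  then show ?thesis
    using assms(1,2) unfolding bracket_def HV_iff[of _ A] HV_iff[of _ B] image_subset_iff
    by (intro HV_sum HV_scale) auto
qed

text \<open>The Jacobi identity on basis vectors, arranged so that it makes \<open>ad\<close> of a
  basis vector a derivation.\<close>

lemma Leibniz_basis_ad: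
  "bracket (basis c) (bracket (basis a) (basis b))
    = bracket (bracket (basis c) (basis a)) (basis b) + bracket (basis a) (bracket (basis c) (basis b))"
  \<comment> \<open>Splitting each second index into zero and successor removes the truncated
    subtraction; the rest is a comparison of coefficients.\<close>
  by (cases a; cases b; cases c; rename_tac \<alpha> i \<beta> j \<gamma> k; case_tac i; case_tac j; case_tac k;
      simp add: LI_basis HI_basis; intro hv_eqI;
      auto simp: lookup_add lookup_minus algebra_simps)


section \<open>Derivations\<close>

lemma lin_ext_superset:
  assumes "x \<in> HV \<Gamma>" "finite S" "Poly_Mapping.keys x \<subseteq> S"
  shows "lin_ext \<Gamma> f x = (\<Sum>b\<in>S. Poly_Mapping.lookup x b *\<^sub>h f b)"
  using assms unfolding lin_ext_def
  by (auto simp: in_keys_iff intro!: sum.mono_neutral_left)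

lemma lin_ext_add:
  assumes "x \<in> HV \<Gamma>" "y \<in> HV \<Gamma>"
  shows "lin_ext \<Gamma> f (x + y) = lin_ext \<Gamma> f x + lin_ext \<Gamma> f y"
proof -
  let ?S = "Poly_Mapping.keys x \<union> Poly_Mapping.keys y"
  have "Poly_Mapping.keys (x + y) \<subseteq> ?S" by (rule Poly_Mapping.keys_add)
  then show ?thesis
    using assms
    by (simp add: lin_ext_superset[of _ \<Gamma> ?S] lookup_add hv.scale_left_distrib sum.distrib)
qed

lemma lin_ext_scale:
  assumes "x \<in> HV \<Gamma>"
  shows "lin_ext \<Gamma> f (c *\<^sub>h x) = c *\<^sub>h lin_ext \<Gamma> f x"
  using assms keys_hv_scale[of c x]
  by (simp add: lin_ext_superset[of _ \<Gamma> "Poly_Mapping.keys x"] hv.scale_sum_right)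

lemma lin_ext_basis: "bdeg b \<in> \<Gamma> \<Longrightarrow> lin_ext \<Gamma> f (basis b) = f b"
  by (simp add: lin_ext_def)

lemma lin_ext_L: "\<alpha> \<in> \<Gamma> \<Longrightarrow> lin_ext \<Gamma> f (L \<alpha> i) = f (LI \<alpha> i)"
  and lin_ext_H: "\<alpha> \<in> \<Gamma> \<Longrightarrow> lin_ext \<Gamma> f (H \<alpha> i) = f (HI \<alpha> i)"
  by (simp_all add: lin_ext_basis flip: LI_basis HI_basis)

section \<open>Eigenvectors of \<open>ad (L 0 0)\<close>\<close>

text \<open>This is \<beta> + d/dt in coordinates: differentiation moves the coefficient at
  \<open>Suc j\<close> down to \<open>j\<close> with factor \<open>Suc j\<close>. The L-part and the
  H-part obey the same rule.\<close>

lemma lookup_bracket_L00: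
  "Poly_Mapping.lookup (bracket (L 0 0) x) (LI \<beta> j) =
    \<beta> * Poly_Mapping.lookup x (LI \<beta> j) + of_nat (Suc j) * Poly_Mapping.lookup x (LI \<beta> (Suc j))"
  (is "?P x")
  "Poly_Mapping.lookup (bracket (L 0 0) x) (HI \<beta> j) =
    \<beta> * Poly_Mapping.lookup x (HI \<beta> j) + of_nat (Suc j) * Poly_Mapping.lookup x (HI \<beta> (Suc j))"
  (is "?Q x")
proof -
  have "x \<in> HV UNIV" by simp
  then have "?P x \<and> ?Q x"
  proof (induction rule: HV_induct)
    case (step c b y)
    then show ?case
      by (cases b; rename_tac \<alpha> i; case_tac i)
        (auto simp: LI_basis HI_basis lookup_add algebra_simps)
  qed simp
  then show "?P x" "?Q x" by blast+
qed

text \<open>A finitely supported eigenvector of the shift recursion vanishes, since a nonzero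
  coefficient would force the next one to be nonzero.\<close>

lemma shift_recursion_zero:
  fixes u :: "nat \<Rightarrow> complex"
  assumes "finite {j. u j \<noteq> 0}" "c \<noteq> 0" "\<And>j. c * u j + of_nat (Suc j) * u (Suc j) = 0"
  shows "u j = 0"
proof (rule ccontr)
  assume "u j \<noteq> 0"
  have "u (j + k) \<noteq> 0" for k
  proof (induction k)
    case (Suc k)
    then show ?case using assms(3)[of "j + k"] \<open>c \<noteq> 0\<close> by auto
  qed (simp add: \<open>u j \<noteq> 0\<close>)
  then have "range ((+) j) \<subseteq> {j. u j \<noteq> 0}" by auto
  then show False
    using assms(1) finite_subset finite_imageD[of "(+) j" UNIV] by auto
qed

text \<open>In degree \<beta> the eigenvalue equation is the shift recursion with constant \<beta> -
  \<alpha>. If this is nonzero, finite support kills all coefficients. For \<beta> = \<alpha> the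
  recursion says that the derivative vanishes, so only second index 0 survives.\<close>

lemma eigenvector_L00:
  assumes "bracket (L 0 0) x = \<alpha> *\<^sub>h x"
  obtains p q where "x = p *\<^sub>h L \<alpha> 0 + q *\<^sub>h H \<alpha> 0"
proof -
  have fin: "finite {j. Poly_Mapping.lookup x (LI \<beta> j) \<noteq> 0}"
    "finite {j. Poly_Mapping.lookup x (HI \<beta> j) \<noteq> 0}" for \<beta>
    using finite_vimageI[of "Poly_Mapping.keys x" "LI \<beta>"]
      finite_vimageI[of "Poly_Mapping.keys x" "HI \<beta>"]
    by (auto simp: vimage_def in_keys_iff inj_def)
  have recL: "(\<beta> - \<alpha>) * Poly_Mapping.lookup x (LI \<beta> j)
        + of_nat (Suc j) * Poly_Mapping.lookup x (LI \<beta> (Suc j)) = 0"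
    and recH: "(\<beta> - \<alpha>) * Poly_Mapping.lookup x (HI \<beta> j)
        + of_nat (Suc j) * Poly_Mapping.lookup x (HI \<beta> (Suc j)) = 0" for \<beta> j
    using lookup_bracket_L00[of x \<beta> j] by (simp_all add: assms algebra_simps)
  have L: "Poly_Mapping.lookup x (LI \<beta> j) = 0" and H: "Poly_Mapping.lookup x (HI \<beta> j) = 0"
    if "\<beta> \<noteq> \<alpha> \<or> j \<noteq> 0" for \<beta> j
    using that recL[of \<beta> "j - 1"] recH[of \<beta> "j - 1"]
      shift_recursion_zero[OF fin(1) _ recL, of \<beta> j] shift_recursion_zero[OF fin(2) _ recH, of \<beta> j]
    by (cases "\<beta> = \<alpha>"; cases j; simp del: of_nat_Suc)+
  have "x = Poly_Mapping.lookup x (LI \<alpha> 0) *\<^sub>h L \<alpha> 0 + Poly_Mapping.lookup x (HI \<alpha> 0) *\<^sub>h H \<alpha> 0"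
    by (rule hv_eqI) (auto simp: lookup_add L H)
  then show thesis by (rule that)
qed

section \<open>The space of derivations of \<open>HV \<Gamma>\<close>\<close>

locale hv_group =
  fixes \<Gamma> :: "complex set"
  assumes zero_mem [simp]: "0 \<in> \<Gamma>"
    and add_mem [simp]: "\<alpha> \<in> \<Gamma> \<Longrightarrow> \<beta> \<in> \<Gamma> \<Longrightarrow> \<alpha> + \<beta> \<in> \<Gamma>"
    and minus_mem [simp]: "\<alpha> \<in> \<Gamma> \<Longrightarrow> - \<alpha> \<in> \<Gamma>"
begin

lemma bracket_mem [simp]: "x \<in> HV \<Gamma> \<Longrightarrow> y \<in> HV \<Gamma> \<Longrightarrow> bracket x y \<in> HV \<Gamma>"
  by (rule bracket_HV) auto

lemma Der_closed [simp]: "D \<in> Der \<Gamma> \<Longrightarrow> x \<in> HV \<Gamma> \<Longrightarrow> D x \<in> HV \<Gamma>"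
  and Der_outside: "D \<in> Der \<Gamma> \<Longrightarrow> x \<notin> HV \<Gamma> \<Longrightarrow> D x = 0"
  and Der_add: "D \<in> Der \<Gamma> \<Longrightarrow> x \<in> HV \<Gamma> \<Longrightarrow> y \<in> HV \<Gamma> \<Longrightarrow> D (x + y) = D x + D y"
  and Der_scale: "D \<in> Der \<Gamma> \<Longrightarrow> x \<in> HV \<Gamma> \<Longrightarrow> D (c *\<^sub>h x) = c *\<^sub>h D x"
  and Der_bracket: "D \<in> Der \<Gamma> \<Longrightarrow> x \<in> HV \<Gamma> \<Longrightarrow> y \<in> HV \<Gamma> \<Longrightarrow>
    D (bracket x y) = bracket (D x) y + bracket x (D y)"
  by (simp_all add: Der_def)

lemma Der_zero: "D \<in> Der \<Gamma> \<Longrightarrow> D 0 = 0"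
  using Der_scale[of D 0 0] by simp

lemma Der_minus: "D \<in> Der \<Gamma> \<Longrightarrow> x \<in> HV \<Gamma> \<Longrightarrow> D (- x) = - D x"
  using Der_scale[of D x "-1"] by simp

lemma Der_diff: "D \<in> Der \<Gamma> \<Longrightarrow> x \<in> HV \<Gamma> \<Longrightarrow> y \<in> HV \<Gamma> \<Longrightarrow> D (x - y) = D x - D y"
  using Der_add[of D x "- y"] by (simp add: Der_minus)

lemmas Der_linear = Der_add Der_scale Der_zero Der_minus Der_diff

text \<open>Both sides of the Leibniz rule are bilinear, so pairs of basis vectors suffice. The rule
  is extended first in the second argument, then in the first.\<close>

lemma DerI_basis:
  assumes outside: "\<And>x. x \<notin> HV \<Gamma> \<Longrightarrow> D x = 0"
    and add: "\<And>x y. x \<in> HV \<Gamma> \<Longrightarrow> y \<in> HV \<Gamma> \<Longrightarrow> D (x + y) = D x + D y"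
    and scale: "\<And>c x. x \<in> HV \<Gamma> \<Longrightarrow> D (c *\<^sub>h x) = c *\<^sub>h D x"
    and closed: "\<And>b. bdeg b \<in> \<Gamma> \<Longrightarrow> D (basis b) \<in> HV \<Gamma>"
    and leibniz: "\<And>a b. bdeg a \<in> \<Gamma> \<Longrightarrow> bdeg b \<in> \<Gamma> \<Longrightarrow>
      D (bracket_basis a b) = bracket (D (basis a)) (basis b) + bracket (basis a) (D (basis b))"
  shows "D \<in> Der \<Gamma>"
proof -
  have zero: "D 0 = 0" using scale[of 0 0] by simp
  have mem: "bracket_basis a b \<in> HV \<Gamma>" if "bdeg a \<in> \<Gamma>" "bdeg b \<in> \<Gamma>" for a b
    using that bracket_mem[of "basis a" "basis b"] by (simp del: bracket_mem)
  have leibniz_left: "D (bracket (basis a) y) = bracket (D (basis a)) y + bracket (basis a) (D y)"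
    if "y \<in> HV \<Gamma>" "bdeg a \<in> \<Gamma>" for a y
    using that(1)
    by (induction rule: HV_induct)
      (use that(2) in \<open>simp_all add: zero add scale leibniz mem hv.scale_right_distrib\<close>)
  have "D (bracket x y) = bracket (D x) y + bracket x (D y)" if "x \<in> HV \<Gamma>" "y \<in> HV \<Gamma>" for x y
    using that(1)
    by (induction rule: HV_induct)
      (use that(2) in \<open>simp_all add: zero add scale leibniz_left hv.scale_right_distrib\<close>)
  moreover have "D x \<in> HV \<Gamma>" if "x \<in> HV \<Gamma>" for x
    using that by (induction rule: HV_induct) (simp_all add: zero add scale closed)
  ultimately show ?thesis
    unfolding Der_def using outside add scale by blast
qed

text \<open>Linearity settles the vectors of \<open>HV \<Gamma>\<close>; elsewhere both maps are
  zero by convention, so the conclusion is equality of functions.\<close>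

lemma Der_eqI:
  assumes "D \<in> Der \<Gamma>" "D' \<in> Der \<Gamma>"
    and LI: "\<And>\<alpha> i. \<alpha> \<in> \<Gamma> \<Longrightarrow> D (L \<alpha> i) = D' (L \<alpha> i)"
    and HI: "\<And>\<alpha> i. \<alpha> \<in> \<Gamma> \<Longrightarrow> D (H \<alpha> i) = D' (H \<alpha> i)"
  shows "D = D'"
proof
  fix x
  have b: "D (basis b) = D' (basis b)" if "bdeg b \<in> \<Gamma>" for b
    using that LI HI by (cases b) (auto simp: LI_basis HI_basis)
  show "D x = D' x"
  proof (cases "x \<in> HV \<Gamma>")
    case True
    then show ?thesis
      by (induction rule: HV_induct) (use assms(1,2) in \<open>simp_all add: Der_linear b\<close>)
  qed (use assms(1,2) in \<open>simp add: Der_outside\<close>)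
qed

lemma subspace_Der: "maps.subspace (Der \<Gamma>)"
  unfolding maps.subspace_def Der_def
  by (auto simp: map_scale_def hv.scale_right_distrib hv.scale_left_commute)

lemmas Der_memI =
  maps.subspace_add[OF subspace_Der] maps.subspace_diff[OF subspace_Der]
  maps.subspace_scale[OF subspace_Der]

lemma ad_apply: "x \<in> HV \<Gamma> \<Longrightarrow> ad \<Gamma> z x = bracket z x"
  by (simp add: ad_def)

lemma ad_add: "ad \<Gamma> (x + y) = ad \<Gamma> x + ad \<Gamma> y"
  and ad_scale: "ad \<Gamma> (c *\<^sub>h x) = map_scale c (ad \<Gamma> x)"
  and ad_zero: "ad \<Gamma> 0 = 0"
  by (auto simp: ad_def map_scale_def fun_eq_iff)

lemma ad_sum: "ad \<Gamma> (\<Sum>i\<in>I. f i) = (\<Sum>i\<in>I. ad \<Gamma> (f i))"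
  by (induction I rule: infinite_finite_induct) (auto simp: ad_add ad_zero)

text \<open>\<open>ad\<close> is linear in its element and \<open>Der \<Gamma>\<close> is a
  subspace, so the claim reduces to basis vectors, where it is the Jacobi identity.\<close>

lemma ad_mem: "z \<in> HV \<Gamma> \<Longrightarrow> ad \<Gamma> z \<in> Der \<Gamma>"
proof (induction rule: HV_induct)
  case zero
  show ?case unfolding ad_zero by (rule maps.subspace_0[OF subspace_Der])
next
  case (step c b y)
  have "ad \<Gamma> (basis b) \<in> Der \<Gamma>"
  proof (rule DerI_basis)
    fix a b' assume ab: "bdeg a \<in> \<Gamma>" "bdeg b' \<in> \<Gamma>"
    then have "bracket_basis a b' \<in> HV \<Gamma>"
      using bracket_mem[of "basis a" "basis b'"] by (simp del: bracket_mem)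
    then show "ad \<Gamma> (basis b) (bracket_basis a b') =
      bracket (ad \<Gamma> (basis b) (basis a)) (basis b') + bracket (basis a) (ad \<Gamma> (basis b) (basis b'))"
      using Leibniz_basis_ad[of b a b'] ab by (simp add: ad_apply)
  next
    fix a assume "bdeg a \<in> \<Gamma>"
    then show "ad \<Gamma> (basis b) (basis a) \<in> HV \<Gamma>"
      using bracket_mem[of "basis b" "basis a"] step(1) by (simp add: ad_apply del: bracket_mem)
  qed (auto simp: ad_def)
  then show ?case
    using step unfolding ad_add ad_scale by (intro Der_memI)
qed

section \<open>The derivations \<open>Dphi\<close>, \<open>D1\<close> and \<open>D2\<close>\<close>

lemma lin_ext_mem:
  assumes "\<And>b. bdeg b \<in> \<Gamma> \<Longrightarrow> f b \<in> HV \<Gamma>"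
    and "\<And>a b. bdeg a \<in> \<Gamma> \<Longrightarrow> bdeg b \<in> \<Gamma> \<Longrightarrow>
      lin_ext \<Gamma> f (bracket_basis a b) = bracket (f a) (basis b) + bracket (basis a) (f b)"
  shows "lin_ext \<Gamma> f \<in> Der \<Gamma>"
  by (rule DerI_basis) (use assms in \<open>auto simp: lin_ext_add lin_ext_scale lin_ext_basis\<close>,
    simp add: lin_ext_def)

lemma lin_ext_zero: "lin_ext \<Gamma> f 0 = 0"
  by (simp add: lin_ext_def)

lemma lin_ext_minus: "x \<in> HV \<Gamma> \<Longrightarrow> lin_ext \<Gamma> f (- x) = - lin_ext \<Gamma> f x"
  using lin_ext_scale[of x \<Gamma> f "-1"] by simp

lemma lin_ext_diff:
  "x \<in> HV \<Gamma> \<Longrightarrow> y \<in> HV \<Gamma> \<Longrightarrow> lin_ext \<Gamma> f (x - y) = lin_ext \<Gamma> f x - lin_ext \<Gamma> f y"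
  using lin_ext_add[of x \<Gamma> "- y" f] by (simp add: lin_ext_minus)

lemmas lin_ext_simps = lin_ext_add lin_ext_scale lin_ext_zero lin_ext_minus lin_ext_diff
  lin_ext_L lin_ext_H

text \<open>A bracket of degrees \<alpha> and \<beta> lies in degree \<alpha> + \<beta>, and
  additivity of \<phi> is the Leibniz rule.\<close>

lemma Dphi_mem: "\<phi> \<in> Hom_Z \<Gamma> \<Longrightarrow> Dphi \<Gamma> \<phi> \<in> Der \<Gamma>"
  unfolding Dphi_def
proof (rule lin_ext_mem, goal_cases)
  case (1 b)
  then show ?case by (cases b) auto
next
  case (2 a b)
  then show ?case
    by (cases a; cases b) (auto simp: lin_ext_simps LI_basis HI_basis Hom_Z_def
      lookup_add lookup_minus algebra_simps intro!: hv_eqI)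
qed

text \<open>Read \<open>L \<alpha> i\<close> as the vector field f d/dt and
  \<open>H \<alpha> i\<close> as the function f, where f is \<open>t^i\<close> times exp(\<alpha>
  t). The brackets become those of vector fields acting on functions, \<open>D1\<close> is the
  divergence sending f d/dt to f', and the Leibniz rule reads (f g' - g f')' = f g'' - g
  f''.\<close>

lemma D1_mem: "D1 \<Gamma> \<in> Der \<Gamma>"
  unfolding D1_def
proof (rule lin_ext_mem, goal_cases)
  case (1 b)
  then show ?case by (cases b) auto
next
  case (2 a b)
  then show ?case
    by (cases a; cases b; rename_tac \<alpha> i \<beta> j; case_tac i; case_tac j;
      simp add: lin_ext_simps LI_basis HI_basis; intro hv_eqI;
      auto simp: lookup_add lookup_minus algebra_simps)
qed

text \<open>Counting factors H grades the algebra: brackets of two L's contain no H, mixed ones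
  exactly one, and brackets of two H's vanish. \<open>D2\<close> is the corresponding degree
  derivation.\<close>

lemma D2_mem: "D2 \<Gamma> \<in> Der \<Gamma>"
  unfolding D2_def
proof (rule lin_ext_mem, goal_cases)
  case (1 b)
  then show ?case by (cases b) auto
next
  case (2 a b)
  then show ?case
    by (cases a; cases b) (simp_all add: lin_ext_simps LI_basis HI_basis)
qed

lemma Dphi_L [simp]: "\<alpha> \<in> \<Gamma> \<Longrightarrow> Dphi \<Gamma> \<phi> (L \<alpha> i) = \<phi> \<alpha> *\<^sub>h L \<alpha> i"
  and Dphi_H [simp]: "\<alpha> \<in> \<Gamma> \<Longrightarrow> Dphi \<Gamma> \<phi> (H \<alpha> i) = \<phi> \<alpha> *\<^sub>h H \<alpha> i"
  by (simp_all add: Dphi_def lin_ext_simps)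

lemma D1_L [simp]: "\<alpha> \<in> \<Gamma> \<Longrightarrow> D1 \<Gamma> (L \<alpha> i) = \<alpha> *\<^sub>h H \<alpha> i + of_nat i *\<^sub>h H \<alpha> (i - 1)"
  and D1_H [simp]: "\<alpha> \<in> \<Gamma> \<Longrightarrow> D1 \<Gamma> (H \<alpha> i) = 0"
  by (simp_all add: D1_def lin_ext_simps)

lemma D2_L [simp]: "\<alpha> \<in> \<Gamma> \<Longrightarrow> D2 \<Gamma> (L \<alpha> i) = 0"
  and D2_H [simp]: "\<alpha> \<in> \<Gamma> \<Longrightarrow> D2 \<Gamma> (H \<alpha> i) = H \<alpha> i"
  by (simp_all add: D2_def lin_ext_simps)


section \<open>Normalising a derivation on \<open>L 0 0\<close>, \<open>L 0 1\<close> and the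
  remaining L's\<close>

text \<open>Makes \<open>D (L 0 0)\<close> the value at \<open>L 0 0\<close> of an inner derivation.
  The image is closed under sums and multiples, so it suffices to reach the basis vectors.\<close>

lemma L00_surj:
  assumes "y \<in> HV \<Gamma>"
  obtains z where "z \<in> HV \<Gamma>" "bracket z (L 0 0) = y"
proof -
  let ?I = "(\<lambda>z. bracket z (L 0 0)) ` HV \<Gamma>"
  have add: "x + y \<in> ?I" if xy: "x \<in> ?I" "y \<in> ?I" for x y
  proof -
    obtain z z' where "z \<in> HV \<Gamma>" "x = bracket z (L 0 0)" "z' \<in> HV \<Gamma>" "y = bracket z' (L 0 0)"
      using xy by blast
    then show ?thesis by (intro image_eqI[of _ _ "z + z'"]) simp_all
  qed
  have scale: "c *\<^sub>h x \<in> ?I" if x: "x \<in> ?I" for c x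
  proof -
    obtain z where "z \<in> HV \<Gamma>" "x = bracket z (L 0 0)"
      using x by blast
    then show ?thesis by (intro image_eqI[of _ _ "c *\<^sub>h z"]) simp_all
  qed
  have LH: "L \<alpha> i \<in> ?I \<and> H \<alpha> i \<in> ?I" if "\<alpha> \<in> \<Gamma>" for \<alpha> i
  proof (cases "\<alpha> = 0")
    case True
    \<comment> \<open>In degree 0 the operator is -d/dt, so a preimage is found by integrating
      \<open>t^i\<close>.\<close>
    have "L 0 i = bracket ((- inverse (of_nat (Suc i))) *\<^sub>h L 0 (Suc i)) (L 0 0)"
      "H 0 i = bracket ((- inverse (of_nat (Suc i))) *\<^sub>h H 0 (Suc i)) (L 0 0)"
      by (auto intro!: hv_eqI simp: lookup_add lookup_minus simp del: of_nat_Suc)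
    then show ?thesis unfolding True by (metis HV_scale L_in_HV H_in_HV zero_mem image_eqI)
  next
    case False
    \<comment> \<open>The bracket formula is solved for its leading term, which needs \<alpha>
      nonzero; the lower term falls to induction on \<open>i\<close>.\<close>
    have up: "L \<alpha> i = (- (1 / \<alpha>)) *\<^sub>h bracket (L \<alpha> i) (L 0 0) + (- (of_nat i / \<alpha>)) *\<^sub>h L \<alpha> (i - 1)"
      "H \<alpha> i = (- (1 / \<alpha>)) *\<^sub>h bracket (H \<alpha> i) (L 0 0) + (- (of_nat i / \<alpha>)) *\<^sub>h H \<alpha> (i - 1)" for i
      by (cases i; use False in \<open>auto intro!: hv_eqI simp: lookup_add lookup_minus field_simps\<close>)+
    have br: "bracket (L \<alpha> i) (L 0 0) \<in> ?I" "bracket (H \<alpha> i) (L 0 0) \<in> ?I" for i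
      using \<open>\<alpha> \<in> \<Gamma>\<close> by (auto simp del: bracket_L_L bracket_H_L)
    show ?thesis
    proof (induction i)
      case 0
      have "L \<alpha> 0 = (- (1 / \<alpha>)) *\<^sub>h bracket (L \<alpha> 0) (L 0 0)"
        "H \<alpha> 0 = (- (1 / \<alpha>)) *\<^sub>h bracket (H \<alpha> 0) (L 0 0)"
        using False by (auto intro!: hv_eqI simp: lookup_add lookup_minus)
      then show ?case using scale[OF br(1)] scale[OF br(2)] by metis
    next
      case (Suc i)
      have "(- (1 / \<alpha>)) *\<^sub>h bracket (L \<alpha> (Suc i)) (L 0 0)
          + (- (of_nat (Suc i) / \<alpha>)) *\<^sub>h L \<alpha> (Suc i - 1) \<in> ?I"
        "(- (1 / \<alpha>)) *\<^sub>h bracket (H \<alpha> (Suc i)) (L 0 0)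
          + (- (of_nat (Suc i) / \<alpha>)) *\<^sub>h H \<alpha> (Suc i - 1) \<in> ?I"
        using Suc by (intro add scale br; simp)+
      then show ?case by (simp only: up[symmetric])
    qed
  qed
  from assms have "y \<in> ?I"
  proof (induction rule: HV_induct)
    case zero
    show ?case by (rule image_eqI[of _ _ 0]) auto
  next
    case (step c b y)
    then show ?case by (cases b) (auto intro!: add scale simp: LI_basis HI_basis LH simp del: image_iff)
  qed
  then show thesis using that by blast
qed

text \<open>As \<open>D\<close> kills \<open>L 0 0\<close>, it commutes with
  \<open>ad (L 0 0)\<close>. The vector \<open>y\<close> is the part of the bracket that
  \<open>D\<close> already kills, typically the next lower vector of the Jordan chain, so
  \<open>D x\<close> is a genuine eigenvector.\<close>

lemma Der_eigen:
  assumes D: "D \<in> Der \<Gamma>" "D (L 0 0) = 0"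
    and x: "x \<in> HV \<Gamma>" "bracket (L 0 0) x = \<alpha> *\<^sub>h x + y" "y \<in> HV \<Gamma>" "D y = 0"
  obtains p q where "D x = p *\<^sub>h L \<alpha> 0 + q *\<^sub>h H \<alpha> 0"
proof -
  have "bracket (L 0 0) (D x) = D (bracket (L 0 0) x)"
    using Der_bracket[OF D(1), of "L 0 0" x] D(2) x by simp
  also have "\<dots> = \<alpha> *\<^sub>h D x"
    using D x by (simp add: Der_linear)
  finally show thesis using eigenvector_L00 that by blast
qed

lemma lookup_cong: "x = y \<Longrightarrow> Poly_Mapping.lookup x b = Poly_Mapping.lookup y b"
  by simp

lemma Der_L0:
  assumes D: "D \<in> Der \<Gamma>" "D (L 0 0) = 0" "D (L 0 1) = 0"
  shows "D (L 0 n) = 0"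
proof (induction n)
  case (Suc n)
  show ?case
  \<comment> \<open>The value at \<open>L 0 1\<close> is a hypothesis and cannot be derived:
    \<open>D1\<close> kills \<open>L 0 0\<close> but sends \<open>L 0 1\<close> to
    \<open>H 0 0\<close>.\<close>
  proof (cases n)
    case (Suc m)
    have "D ((of_nat (Suc n)) *\<^sub>h L 0 n) = 0"
      using D \<open>D (L 0 n) = 0\<close> by (simp add: Der_linear)
    then obtain p q where pq: "D (L 0 (Suc n)) = p *\<^sub>h L 0 0 + q *\<^sub>h H 0 0"
      using Der_eigen[OF D(1,2), of "L 0 (Suc n)" 0 "of_nat (Suc n) *\<^sub>h L 0 n"] by auto
    \<comment> \<open>\<open>D\<close> commutes with \<open>ad (L 0 1)\<close> too. For this
      operator \<open>L 0 (Suc n)\<close> has eigenvalue \<open>n\<close>, while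
      \<open>L 0 0\<close> and \<open>H 0 0\<close> have eigenvalues -1 and 0, so both scalars
      vanish for \<open>n\<close> positive.\<close>
    have "of_nat n *\<^sub>h D (L 0 (Suc n)) = D (bracket (L 0 1) (L 0 (Suc n)))"
      using D by (simp add: Der_linear)
    also have "\<dots> = - (p *\<^sub>h L 0 0)"
      using D by (simp add: Der_bracket pq del: bracket_L_L)
        (auto intro!: hv_eqI simp: lookup_add lookup_minus)
    finally have eq: "of_nat n *\<^sub>h D (L 0 (Suc n)) = - (p *\<^sub>h L 0 0)" .
    have "(of_nat n + 1) * p = 0" "of_nat n * q = 0"
      using lookup_cong[OF eq, of "LI 0 0"] lookup_cong[OF eq, of "HI 0 0"]
      by (auto simp: pq lookup_add lookup_minus algebra_simps)
    moreover have "(of_nat n :: complex) \<noteq> 0"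
      using Suc by (simp only: of_nat_eq_0_iff)
    moreover have "(of_nat n + 1 :: complex) \<noteq> 0"
      using of_nat_neq_0[of n, where 'a = complex] by (simp add: add.commute)
    ultimately have "p = 0" "q = 0" by auto
    then show ?thesis using pq by simp
  qed (use D in simp)
qed (use D in simp)

text \<open>The bracket of \<open>L 0 2\<close> with \<open>L \<alpha> 0\<close> is also obtained by applying \<open>L 0 1\<close> twice, which
  rules out an \<open>H\<close>-component of \<open>D (L \<alpha> 0)\<close>.\<close>

lemma Der_L_eigen:
  assumes D: "D \<in> Der \<Gamma>" "D (L 0 0) = 0" "D (L 0 1) = 0" and \<alpha>: "\<alpha> \<in> \<Gamma>"
  obtains p where "D (L \<alpha> 0) = p *\<^sub>h L \<alpha> 0"
proof (cases "\<alpha> = 0")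
  case True
  then show thesis using that[of 0] D by simp
next
  case False
  obtain p q where pq: "D (L \<alpha> 0) = p *\<^sub>h L \<alpha> 0 + q *\<^sub>h H \<alpha> 0"
    using Der_eigen[OF D(1,2), of "L \<alpha> 0" \<alpha> 0] D \<alpha> by (auto simp: Der_zero)
  have D2: "D (L 0 2) = 0" by (rule Der_L0[OF D])
  have "\<alpha> *\<^sub>h D (L \<alpha> 1) - D (L \<alpha> 0) = D (bracket (L 0 1) (L \<alpha> 0))"
    using D \<alpha> by (simp add: Der_linear)
  also have "\<dots> = bracket (L 0 1) (D (L \<alpha> 0))"
    using D \<alpha> by (subst Der_bracket) auto
  finally have e1: "\<alpha> *\<^sub>h D (L \<alpha> 1) - D (L \<alpha> 0) = bracket (L 0 1) (D (L \<alpha> 0))" .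
  \<comment> \<open>The bracket of \<open>L 0 1\<close> with \<open>L \<alpha> 0\<close> has a lower
    term, that with \<open>H \<alpha> 0\<close> has none; this mismatch leaves the summand with
    coefficient \<open>q / \<alpha>\<close>.\<close>
  have "\<alpha> *\<^sub>h D (L \<alpha> 1) = \<alpha> *\<^sub>h (p *\<^sub>h L \<alpha> 1 + (q / \<alpha>) *\<^sub>h H \<alpha> 0 + q *\<^sub>h H \<alpha> 1)"
    using e1 False by (simp add: pq diff_eq_eq)
      (auto intro!: hv_eqI simp: lookup_add lookup_minus algebra_simps)
  then have DL1: "D (L \<alpha> 1) = p *\<^sub>h L \<alpha> 1 + (q / \<alpha>) *\<^sub>h H \<alpha> 0 + q *\<^sub>h H \<alpha> 1"
    using False by (simp add: hv.scale_left_imp_eq)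
  have "\<alpha> *\<^sub>h D (L \<alpha> 2) = D (bracket (L 0 1) (L \<alpha> 1))"
    using D \<alpha> by (simp add: Der_linear numeral_2_eq_2)
  also have "\<dots> = bracket (L 0 1) (D (L \<alpha> 1))"
    using D \<alpha> by (subst Der_bracket) auto
  finally have e2: "\<alpha> *\<^sub>h D (L \<alpha> 2) = bracket (L 0 1) (D (L \<alpha> 1))" .
  have "\<alpha> *\<^sub>h D (L \<alpha> 2) - 2 *\<^sub>h D (L \<alpha> 1) = D (bracket (L 0 2) (L \<alpha> 0))"
    using D \<alpha> by (simp add: Der_linear)
  also have "\<dots> = bracket (L 0 2) (D (L \<alpha> 0))"
    using D D2 \<alpha> by (subst Der_bracket) auto
  finally have "bracket (L 0 1) (D (L \<alpha> 1)) - 2 *\<^sub>h D (L \<alpha> 1) = bracket (L 0 2) (D (L \<alpha> 0))"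
    by (simp only: e2)
  \<comment> \<open>Neither bracket has an \<open>H \<alpha> 0\<close> component, so the coefficient
    comparison leaves -2 \<open>q / \<alpha>\<close> = 0.\<close>
  from lookup_cong[OF this, of "HI \<alpha> 0"] have "q = 0"
    using False by (simp add: DL1[unfolded One_nat_def] pq lookup_add lookup_minus)
  then show thesis using that[of p] pq by simp
qed


text \<open>The eigenvalue of \<open>D\<close> at \<open>L \<alpha> 0\<close> defines \<phi>. Since
  \<open>D\<close> kills every \<open>L 0 n\<close>, bracketing \<open>L \<alpha> 0\<close> with
  these carries the eigenvalue up to all \<open>L \<alpha> n\<close> when \<alpha> is
  nonzero.\<close>

lemma Der_L_Hom:
  assumes D: "D \<in> Der \<Gamma>" "D (L 0 0) = 0" "D (L 0 1) = 0"
  obtains \<phi> where "\<phi> \<in> Hom_Z \<Gamma>" "\<And>\<alpha> n. \<alpha> \<in> \<Gamma> \<Longrightarrow> D (L \<alpha> n) = \<phi> \<alpha> *\<^sub>h L \<alpha> n"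
proof -
  define \<phi> where "\<phi> \<alpha> = (if \<alpha> \<in> \<Gamma> then Poly_Mapping.lookup (D (L \<alpha> 0)) (LI \<alpha> 0) else 0)" for \<alpha>
  have \<phi>: "D (L \<alpha> 0) = \<phi> \<alpha> *\<^sub>h L \<alpha> 0" if \<alpha>: "\<alpha> \<in> \<Gamma>" for \<alpha>
    using Der_L_eigen[OF D \<alpha>] \<alpha> by (force simp: \<phi>_def)
  have \<phi>0: "\<phi> 0 = 0" using D by (simp add: \<phi>_def)
  have DL: "D (L \<alpha> n) = \<phi> \<alpha> *\<^sub>h L \<alpha> n" if \<alpha>: "\<alpha> \<in> \<Gamma>" for \<alpha> n
  proof (cases "\<alpha> = 0")
    case True
    then show ?thesis using Der_L0[OF D] \<phi>0 by simp
  next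
    case False
    show ?thesis
    proof (induction n)
      case (Suc n)
      have "\<alpha> *\<^sub>h D (L \<alpha> (Suc n)) - of_nat (Suc n) *\<^sub>h D (L \<alpha> n) = D (bracket (L 0 (Suc n)) (L \<alpha> 0))"
        using D \<alpha> by (simp add: Der_linear del: of_nat_Suc)
      also have "\<dots> = \<phi> \<alpha> *\<^sub>h bracket (L 0 (Suc n)) (L \<alpha> 0)"
        using D \<alpha> Der_L0[OF D, of "Suc n"] by (subst Der_bracket) (auto simp: \<phi> simp del: bracket_L_L)
      finally have "\<alpha> *\<^sub>h D (L \<alpha> (Suc n)) = \<alpha> *\<^sub>h (\<phi> \<alpha> *\<^sub>h L \<alpha> (Suc n))"
        by (simp add: Suc diff_eq_eq del: of_nat_Suc)
          (auto intro!: hv_eqI simp: lookup_add lookup_minus algebra_simps)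
      then show ?case using False by (simp add: hv.scale_left_imp_eq)
    qed (simp add: \<phi> \<alpha>)
  qed
  have "\<phi> (\<alpha> + \<beta>) = \<phi> \<alpha> + \<phi> \<beta>" if "\<alpha> \<in> \<Gamma>" "\<beta> \<in> \<Gamma>" for \<alpha> \<beta>
  proof -
    \<comment> \<open>Second indices 0 and 1 give the term \<open>L (\<alpha> + \<beta>) 0\<close>
      the coefficient 1, so the bracket is nonzero even for \<alpha> = \<beta>.\<close>
    have "(\<phi> \<alpha> + \<phi> \<beta>) *\<^sub>h bracket (L \<alpha> 0) (L \<beta> 1) = D (bracket (L \<alpha> 0) (L \<beta> 1))"
      using that D by (subst Der_bracket) (auto simp: DL hv.scale_left_distrib simp del: bracket_L_L)
    also have "\<dots> = \<phi> (\<alpha> + \<beta>) *\<^sub>h bracket (L \<alpha> 0) (L \<beta> 1)"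
      using that D by (simp add: DL Der_linear hv.scale_right_distrib mult.commute)
    finally have eq: "(\<phi> \<alpha> + \<phi> \<beta>) *\<^sub>h bracket (L \<alpha> 0) (L \<beta> 1) = \<phi> (\<alpha> + \<beta>) *\<^sub>h bracket (L \<alpha> 0) (L \<beta> 1)" .
    show ?thesis
      using lookup_cong[OF eq, of "LI (\<alpha> + \<beta>) 0"] by (simp add: lookup_add)
  qed
  then have "\<phi> \<in> Hom_Z \<Gamma>" by (auto simp: Hom_Z_def \<phi>_def)
  then show thesis using DL that by blast
qed

text \<open>The multiple of \<open>D2\<close> is read off at \<open>H 0 0\<close>. After its
  subtraction \<open>H 0 0\<close> and \<open>H 0 1\<close> are killed, and \<open>H 0 1\<close>
  generates all H's under the L's.\<close>

lemma Der_vanishing_on_L: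
  assumes D: "D \<in> Der \<Gamma>" and DL: "\<And>\<alpha> n. \<alpha> \<in> \<Gamma> \<Longrightarrow> D (L \<alpha> n) = 0"
  obtains c where "D = map_scale c (D2 \<Gamma>)"
proof -
  obtain p q where pq: "D (H 0 0) = p *\<^sub>h L 0 0 + q *\<^sub>h H 0 0"
    using Der_eigen[OF D, of "H 0 0" 0 0] by (auto simp: DL Der_zero[OF D])
  have "bracket (L 0 1) (D (H 0 0)) = 0"
    using Der_bracket[OF D, of "L 0 1" "H 0 0"] by (simp add: DL Der_zero[OF D])
  from lookup_cong[OF this, of "LI 0 0"] have "p = 0" by (simp add: pq lookup_add)
  define E where "E = D - map_scale q (D2 \<Gamma>)"
  have E: "E \<in> Der \<Gamma>" unfolding E_def by (intro Der_memI D D2_mem)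
  have EL: "E (L \<alpha> n) = 0" if "\<alpha> \<in> \<Gamma>" for \<alpha> n
    using that by (simp add: E_def DL map_scale_def)
  have E0: "E (H 0 0) = 0"
    using \<open>p = 0\<close> pq by (simp add: E_def map_scale_def)
  obtain p' q' where pq': "E (H 0 1) = p' *\<^sub>h L 0 0 + q' *\<^sub>h H 0 0"
    using Der_eigen[OF E, of "H 0 1" 0 "H 0 0"] by (auto simp: EL E0)
  \<comment> \<open>\<open>H 0 1\<close> has eigenvalue 1 under \<open>ad (L 0 1)\<close>, but
    \<open>L 0 0\<close> and \<open>H 0 0\<close> have eigenvalues -1 and 0, so no combination of
    them can be its image.\<close>
  have eq: "bracket (L 0 1) (E (H 0 1)) = E (H 0 1)"
    using Der_bracket[OF E, of "L 0 1" "H 0 1"] by (simp add: EL)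
  have "p' = 0" "q' = 0"
    using lookup_cong[OF eq, of "LI 0 0"] lookup_cong[OF eq, of "HI 0 0"]
    by (auto simp: pq'[unfolded One_nat_def] lookup_add lookup_minus)
  then have E1: "E (H 0 1) = 0" using pq' by simp
  \<comment> \<open>The bracket of \<open>L \<alpha> n\<close> with \<open>H 0 1\<close> is exactly
    \<open>H \<alpha> n\<close>.\<close>
  have EH: "E (H \<alpha> n) = 0" if "\<alpha> \<in> \<Gamma>" for \<alpha> n
    using Der_bracket[OF E, of "L \<alpha> n" "H 0 1"] that EL E1 by simp
  have "D = map_scale q (D2 \<Gamma>)"
    using D D2_mem EL EH
    by (intro Der_eqI Der_memI) (auto simp: E_def)
  then show thesis by (rule that)
qed

section \<open>Existence and uniqueness of the decomposition\<close>

lemma Der_decomp: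
  assumes D: "D \<in> Der \<Gamma>"
  obtains z \<phi> b c where "z \<in> HV \<Gamma>" "\<phi> \<in> Hom_Z \<Gamma>"
    "D = ad \<Gamma> z + Dphi \<Gamma> \<phi> + map_scale b (D1 \<Gamma>) + map_scale c (D2 \<Gamma>)"
proof -
  obtain y where y: "y \<in> HV \<Gamma>" "bracket y (L 0 0) = D (L 0 0)"
    using L00_surj[of "D (L 0 0)"] D by auto
  define E where "E = D - ad \<Gamma> y"
  have E: "E \<in> Der \<Gamma>" unfolding E_def by (intro Der_memI D ad_mem y)
  have E0: "E (L 0 0) = 0" by (simp add: E_def ad_apply y)
  obtain a b where ab: "E (L 0 1) = a *\<^sub>h L 0 0 + b *\<^sub>h H 0 0"
    using Der_eigen[OF E E0, of "L 0 1" 0 "L 0 0"] by (auto simp: E0)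
  \<comment> \<open>\<open>ad (L 0 0)\<close> and \<open>D1\<close> send \<open>L 0 1\<close> to
    \<open>L 0 0\<close> and \<open>H 0 0\<close> respectively, and both kill \<open>L 0 0\<close>;
    so the value at \<open>L 0 1\<close> is removed without disturbing the first
    normalisation.\<close>
  define F where "F = E - ad \<Gamma> (a *\<^sub>h L 0 0) - map_scale b (D1 \<Gamma>)"
  have F: "F \<in> Der \<Gamma>" unfolding F_def by (intro Der_memI E ad_mem D1_mem) simp
  have "F (L 0 0) = 0" "F (L 0 1) = 0"
    using ab by (simp_all add: F_def E0 ad_apply map_scale_def)
  then obtain \<phi> where \<phi>: "\<phi> \<in> Hom_Z \<Gamma>" "\<And>\<alpha> n. \<alpha> \<in> \<Gamma> \<Longrightarrow> F (L \<alpha> n) = \<phi> \<alpha> *\<^sub>h L \<alpha> n"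
    using Der_L_Hom[OF F] by metis
  have "F - Dphi \<Gamma> \<phi> \<in> Der \<Gamma>" by (intro Der_memI F Dphi_mem \<phi>)
  then obtain c where c: "F - Dphi \<Gamma> \<phi> = map_scale c (D2 \<Gamma>)"
    by (rule Der_vanishing_on_L) (auto simp: \<phi>)
  have "D = ad \<Gamma> (y + a *\<^sub>h L 0 0) + Dphi \<Gamma> \<phi> + map_scale b (D1 \<Gamma>) + map_scale c (D2 \<Gamma>)"
    unfolding c[symmetric] F_def E_def ad_add
    by (simp only: diff_conv_add_uminus) (simp add: algebra_simps)
  then show thesis using that[of "y + a *\<^sub>h L 0 0" \<phi> b c] y \<phi> by simp
qed

lemma bracket_L00_right: "bracket z (L 0 0) = - bracket (L 0 0) z"
proof -
  have "z \<in> HV UNIV" by simp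
  then show ?thesis
  proof (induction rule: HV_induct)
    case (step c b y)
    then show ?case
      by (cases b) (auto simp: LI_basis HI_basis lookup_add lookup_minus algebra_simps intro!: hv_eqI)
  qed simp
qed

text \<open>Evaluation at \<open>L 0 0\<close>, \<open>L 0 1\<close>, \<open>H 0 0\<close> and
  \<open>L \<alpha> 0\<close> isolates the unknowns one after another. The inner part is determined
  only as a map, because \<open>H 0 0\<close> is central and \<open>ad\<close> is not
  injective.\<close>

lemma Der_decomp_unique:
  assumes z: "z \<in> HV \<Gamma>" and \<phi>: "\<phi> \<in> Hom_Z \<Gamma>"
    and eq: "ad \<Gamma> z + Dphi \<Gamma> \<phi> + map_scale b (D1 \<Gamma>) + map_scale c (D2 \<Gamma>) = 0"
  shows "ad \<Gamma> z = 0" "\<phi> = 0" "b = 0" "c = 0"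
proof -
  have \<phi>0: "\<phi> 0 = 0" using \<phi> unfolding Hom_Z_def by (fastforce dest: bspec[of _ _ 0])
  have ev: "ad \<Gamma> z x + Dphi \<Gamma> \<phi> x + b *\<^sub>h D1 \<Gamma> x + c *\<^sub>h D2 \<Gamma> x = 0" for x
    using fun_cong[OF eq, of x] by (simp add: map_scale_def)
  have "bracket z (L 0 0) = 0" using ev[of "L 0 0"] by (simp add: ad_apply \<phi>0)
  then have "bracket (L 0 0) z = 0 *\<^sub>h z" by (simp add: bracket_L00_right)
  then obtain p q where pq: "z = p *\<^sub>h L 0 0 + q *\<^sub>h H 0 0" by (rule eigenvector_L00)
  have "p *\<^sub>h L 0 0 + b *\<^sub>h H 0 0 = 0" using ev[of "L 0 1"] by (simp add: ad_apply \<phi>0 pq)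
  from lookup_cong[OF this, of "LI 0 0"] lookup_cong[OF this, of "HI 0 0"]
  have "p = 0" "b = 0" by (simp_all add: lookup_add)
  show "b = 0" by fact
  have z_eq: "z = q *\<^sub>h H 0 0" using pq \<open>p = 0\<close> by simp
  show ad0: "ad \<Gamma> z = 0"
    by (rule Der_eqI[OF ad_mem[OF z] maps.subspace_0[OF subspace_Der]]) (simp_all add: ad_apply z_eq)
  have "c *\<^sub>h H 0 0 = 0" using ev[of "H 0 0"] by (simp add: ad0 \<phi>0)
  from lookup_cong[OF this, of "HI 0 0"] show "c = 0" by simp
  show "\<phi> = 0"
  proof
    fix \<alpha>
    show "\<phi> \<alpha> = 0 \<alpha>"
    proof (cases "\<alpha> \<in> \<Gamma>")
      case True
      then have "\<phi> \<alpha> *\<^sub>h L \<alpha> 0 = 0" using ev[of "L \<alpha> 0"] by (simp add: ad0 \<open>b = 0\<close>)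
      from lookup_cong[OF this, of "LI \<alpha> 0"] show ?thesis by simp
    qed (use \<phi> in \<open>simp add: Hom_Z_def\<close>)
  qed
qed


section \<open>The grading\<close>

lemma Der_degI:
  assumes D: "D \<in> Der \<Gamma>"
    and LI: "\<And>\<alpha> i. \<alpha> \<in> \<Gamma> \<Longrightarrow> D (L \<alpha> i) \<in> HV {\<alpha> + \<gamma>}"
    and HI: "\<And>\<alpha> i. \<alpha> \<in> \<Gamma> \<Longrightarrow> D (H \<alpha> i) \<in> HV {\<alpha> + \<gamma>}"
  shows "D \<in> Der_deg \<Gamma> \<gamma>"
proof -
  have "D x \<in> HV {\<alpha> + \<gamma>}" if \<alpha>: "\<alpha> \<in> \<Gamma>" and x: "x \<in> HV {\<alpha>}" for \<alpha> x
    using x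
  proof (induction rule: HV_induct)
    case (step c b y)
    have "y \<in> HV \<Gamma>" using step(2) \<alpha> by (auto simp: HV_iff)
    moreover have "D (basis b) \<in> HV {\<alpha> + \<gamma>}"
      using step(1) \<alpha> LI HI by (cases b) (auto simp: LI_basis HI_basis)
    ultimately show ?case using D \<alpha> step by (simp add: Der_linear)
  qed (simp add: Der_zero D)
  then show ?thesis using D by (auto simp: Der_deg_def HV_comp_eq)
qed

lemma Der_deg_Der: "D \<in> Der_deg \<Gamma> \<gamma> \<Longrightarrow> D \<in> Der \<Gamma>"
  by (simp add: Der_deg_def)

lemma Der_deg_apply: "D \<in> Der_deg \<Gamma> \<gamma> \<Longrightarrow> \<alpha> \<in> \<Gamma> \<Longrightarrow> x \<in> HV {\<alpha>} \<Longrightarrow> D x \<in> HV {\<alpha> + \<gamma>}"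
  by (auto simp: Der_deg_def HV_comp_eq)

lemma ad_Der_deg: "\<gamma> \<in> \<Gamma> \<Longrightarrow> z \<in> HV {\<gamma>} \<Longrightarrow> ad \<Gamma> z \<in> Der_deg \<Gamma> \<gamma>"
proof (rule Der_degI)
  assume *: "\<gamma> \<in> \<Gamma>" "z \<in> HV {\<gamma>}"
  then show "ad \<Gamma> z \<in> Der \<Gamma>" by (intro ad_mem) (auto simp: HV_iff)
  show "ad \<Gamma> z (L \<alpha> i) \<in> HV {\<alpha> + \<gamma>}" "ad \<Gamma> z (H \<alpha> i) \<in> HV {\<alpha> + \<gamma>}" if "\<alpha> \<in> \<Gamma>" for \<alpha> i
    using that bracket_HV[OF *(2), of _ "{\<alpha>}" "{\<alpha> + \<gamma>}"] by (simp_all add: ad_apply add.commute)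
qed

lemma Dphi_Der_deg: "\<phi> \<in> Hom_Z \<Gamma> \<Longrightarrow> Dphi \<Gamma> \<phi> \<in> Der_deg \<Gamma> 0"
  by (rule Der_degI) (simp_all add: Dphi_mem)

lemma D1_Der_deg: "D1 \<Gamma> \<in> Der_deg \<Gamma> 0"
  by (rule Der_degI) (simp_all add: D1_mem)

lemma D2_Der_deg: "D2 \<Gamma> \<in> Der_deg \<Gamma> 0"
  by (rule Der_degI) (simp_all add: D2_mem)

lemma subspace_Der_deg: "maps.subspace (Der_deg \<Gamma> \<gamma>)"
  using subspace_Der unfolding maps.subspace_def Der_deg_def HV_comp_eq
  by (auto simp: image_subset_iff map_scale_def)

text \<open>A basis vector has one degree, and as \<open>h\<close> is injective at most one summand
  can involve it, so no cancellation is possible. The map \<open>h\<close> allows for shifted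
  degrees.\<close>

lemma homogeneous_independent:
  assumes "finite S" "inj_on h S" "\<And>i. i \<in> S \<Longrightarrow> g i \<in> HV {h i}" "sum g S = 0" "i \<in> S"
  shows "g i = 0"
proof (rule poly_mapping_eqI)
  fix b
  have other: "Poly_Mapping.lookup (g j) b = 0" if "j \<in> S" "bdeg b \<noteq> h j" for j
    using assms(3)[OF that(1)] that(2) by (auto simp: HV_iff image_subset_iff in_keys_iff)
  show "Poly_Mapping.lookup (g i) b = Poly_Mapping.lookup 0 b"
  proof (cases "bdeg b = h i")
    case True
    have "(\<Sum>j\<in>S. Poly_Mapping.lookup (g j) b) = Poly_Mapping.lookup (g i) b"
      using assms(1,2,5) other True
      by (subst sum.remove[of S i]) (auto intro!: sum.neutral dest: inj_onD)
    then show ?thesis using assms(4) by (metis lookup_sum lookup_zero)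
  qed (use other assms(5) in simp)
qed

lemma sum_apply: "(\<Sum>i\<in>S. f i) (x :: hv) = (\<Sum>i\<in>S. f i x :: hv)"
  by (induction S rule: infinite_finite_induct) auto

text \<open>At a vector of degree \<alpha> the summands take values in the distinct degrees \<alpha>
  + \<gamma>.\<close>

lemma Der_deg_independent:
  assumes "finite S" "S \<subseteq> \<Gamma>" and f: "\<And>\<gamma>. \<gamma> \<in> S \<Longrightarrow> f \<gamma> \<in> Der_deg \<Gamma> \<gamma>"
    and sum: "sum f S = 0" and \<gamma>: "\<gamma> \<in> S"
  shows "f \<gamma> = 0"
proof -
  have "f \<gamma> x = 0" if "\<alpha> \<in> \<Gamma>" "x \<in> HV {\<alpha>}" for \<alpha> x
  proof (rule homogeneous_independent[of S "(+) \<alpha>" "\<lambda>\<gamma>. f \<gamma> x"])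
    show "(\<Sum>\<gamma>\<in>S. f \<gamma> x) = 0" using sum by (simp flip: sum_apply)
  qed (use assms that in \<open>auto intro: Der_deg_apply\<close>)
  then show ?thesis
    by (intro Der_eqI[OF Der_deg_Der[OF f[OF \<gamma>]] maps.subspace_0[OF subspace_Der]]) auto
qed

lemma HV_homogeneous_decomp:
  assumes "z \<in> HV \<Gamma>"
  obtains S f where "finite S" "S \<subseteq> \<Gamma>" "\<And>\<gamma>. f \<gamma> \<in> HV {\<gamma>}" "z = sum f S"
proof
  let ?K = "Poly_Mapping.keys z"
  let ?f = "\<lambda>\<gamma>. \<Sum>b\<in>{b\<in>?K. bdeg b = \<gamma>}. Poly_Mapping.lookup z b *\<^sub>h basis b"
  show "finite (bdeg ` ?K)" "bdeg ` ?K \<subseteq> \<Gamma>" using assms by (simp_all add: HV_iff)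
  show "?f \<gamma> \<in> HV {\<gamma>}" for \<gamma> by (intro HV_sum HV_scale) simp
  have "z = (\<Sum>b\<in>?K. Poly_Mapping.lookup z b *\<^sub>h basis b)"
    by (rule hv_expansion) auto
  also have "\<dots> = sum ?f (bdeg ` ?K)"
    by (rule sum.image_gen) simp
  finally show "z = sum ?f (bdeg ` ?K)" .
qed

text \<open>The three outer terms of \<open>Der_decomp\<close> have degree 0, and \<open>z\<close>
  has finitely many homogeneous components. Hence the sum is finite and its terms of nonzero degree
  are inner.\<close>

lemma Der_homogeneous_decomp:
  assumes "D \<in> Der \<Gamma>"
  obtains S f where "finite S" "S \<subseteq> \<Gamma>" "\<And>\<gamma>. \<gamma> \<in> \<Gamma> \<Longrightarrow> f \<gamma> \<in> Der_deg \<Gamma> \<gamma>"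
    "\<And>\<gamma>. \<gamma> \<in> \<Gamma> \<Longrightarrow> \<gamma> \<noteq> 0 \<Longrightarrow> f \<gamma> \<in> adHV \<Gamma>" "D = sum f S"
proof -
  obtain z \<phi> b c where *: "z \<in> HV \<Gamma>" "\<phi> \<in> Hom_Z \<Gamma>"
    and D: "D = ad \<Gamma> z + Dphi \<Gamma> \<phi> + map_scale b (D1 \<Gamma>) + map_scale c (D2 \<Gamma>)"
    using Der_decomp[OF assms] .
  obtain S g where S: "finite S" "S \<subseteq> \<Gamma>" and g: "\<And>\<gamma>. g \<gamma> \<in> HV {\<gamma>}" "z = sum g S"
    by (rule HV_homogeneous_decomp[OF *(1)]) blast
  define R where "R = Dphi \<Gamma> \<phi> + map_scale b (D1 \<Gamma>) + map_scale c (D2 \<Gamma>)"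
  have R: "R \<in> Der_deg \<Gamma> 0"
    unfolding R_def using *(2) subspace_Der_deg
    by (intro maps.subspace_add maps.subspace_scale Dphi_Der_deg D1_Der_deg D2_Der_deg)
  define f where "f \<gamma> = (if \<gamma> \<in> S then ad \<Gamma> (g \<gamma>) else 0) + (if \<gamma> = 0 then R else 0)" for \<gamma>
  show thesis
  proof
    \<comment> \<open>Degree 0 is added since the outer part lives there even if \<open>z\<close>
      has no component of that degree.\<close>
    show "finite (insert 0 S)" "insert 0 S \<subseteq> \<Gamma>" using S by auto
    show "f \<gamma> \<in> Der_deg \<Gamma> \<gamma>" if "\<gamma> \<in> \<Gamma>" for \<gamma>
      unfolding f_def
      by (rule maps.subspace_add[OF subspace_Der_deg])
        (use that R g in \<open>auto intro: ad_Der_deg maps.subspace_0[OF subspace_Der_deg]\<close>)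
    show "f \<gamma> \<in> adHV \<Gamma>" if "\<gamma> \<in> \<Gamma>" "\<gamma> \<noteq> 0" for \<gamma>
    proof -
      have "g \<gamma> \<in> HV \<Gamma>" using g(1)[of \<gamma>] that by (auto simp: HV_iff)
      moreover have "f \<gamma> = ad \<Gamma> (if \<gamma> \<in> S then g \<gamma> else 0)"
        using that by (auto simp: f_def ad_zero)
      ultimately show ?thesis unfolding adHV_def by auto
    qed
    have "sum f (insert 0 S) = (\<Sum>\<gamma>\<in>insert 0 S. if \<gamma> \<in> S then ad \<Gamma> (g \<gamma>) else 0)
        + (\<Sum>\<gamma>\<in>insert 0 S. if \<gamma> = 0 then R else 0)"
      unfolding f_def by (rule sum.distrib)
    also have "(\<Sum>\<gamma>\<in>insert 0 S. if \<gamma> = 0 then R else 0) = R"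
      using S by (subst sum.delta) simp_all
    also have "(\<Sum>\<gamma>\<in>insert 0 S. if \<gamma> \<in> S then ad \<Gamma> (g \<gamma>) else 0) = (\<Sum>\<gamma>\<in>S. ad \<Gamma> (g \<gamma>))"
      using S by (intro sum.mono_neutral_cong_right) auto
    finally show "D = sum f (insert 0 S)"
      by (simp only: D R_def g(2) ad_sum add.assoc)
  qed
qed

lemma Der_deg_inner:
  assumes \<gamma>: "\<gamma> \<in> \<Gamma>" "\<gamma> \<noteq> 0" and D: "D \<in> Der_deg \<Gamma> \<gamma>"
  shows "D \<in> adHV \<Gamma>"
proof -
  obtain S f where S: "finite S" "S \<subseteq> \<Gamma>" and f: "\<And>\<gamma>. \<gamma> \<in> \<Gamma> \<Longrightarrow> f \<gamma> \<in> Der_deg \<Gamma> \<gamma>"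
    "\<And>\<gamma>. \<gamma> \<in> \<Gamma> \<Longrightarrow> \<gamma> \<noteq> 0 \<Longrightarrow> f \<gamma> \<in> adHV \<Gamma>" and D_eq: "D = sum f S"
    by (rule Der_homogeneous_decomp[OF Der_deg_Der[OF D]]) blast
  \<comment> \<open>The decomposition of \<open>D\<close> minus \<open>D\<close> itself, placed in
    degree \<gamma>, is a homogeneous family with sum 0. Independence then identifies
    \<open>D\<close> with its own component.\<close>
  define g where "g \<delta> = (if \<delta> \<in> S then f \<delta> else 0) - (if \<delta> = \<gamma> then D else 0)" for \<delta>
  have "sum g (insert \<gamma> S) = (\<Sum>\<delta>\<in>insert \<gamma> S. if \<delta> \<in> S then f \<delta> else 0)
      - (\<Sum>\<delta>\<in>insert \<gamma> S. if \<delta> = \<gamma> then D else 0)"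
    unfolding g_def by (rule sum_subtractf)
  also have "(\<Sum>\<delta>\<in>insert \<gamma> S. if \<delta> = \<gamma> then D else 0) = D"
    using S by (subst sum.delta) simp_all
  also have "(\<Sum>\<delta>\<in>insert \<gamma> S. if \<delta> \<in> S then f \<delta> else 0) = sum f S"
    using S by (intro sum.mono_neutral_cong_right) auto
  finally have sum: "sum g (insert \<gamma> S) = 0" by (simp only: D_eq diff_self)
  have "g \<delta> \<in> Der_deg \<Gamma> \<delta>" if "\<delta> \<in> insert \<gamma> S" for \<delta>
    unfolding g_def
    by (rule maps.subspace_diff[OF subspace_Der_deg])
      (use that S D f in \<open>auto intro: maps.subspace_0[OF subspace_Der_deg]\<close>)
  then have "g \<gamma> = 0"
    using S \<gamma> sum by (intro Der_deg_independent[of "insert \<gamma> S" g]) auto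
  then have "D = (if \<gamma> \<in> S then f \<gamma> else 0)"
    by (simp only: g_def right_minus_eq if_True refl)
  moreover have "0 \<in> adHV \<Gamma>"
    unfolding adHV_def using ad_zero by (intro image_eqI[of _ _ 0]) (simp_all only: HV_zero)
  ultimately show ?thesis using f(2)[OF \<gamma>] by (cases "\<gamma> \<in> S") (simp_all only: if_True if_False)
qed

lemma subspace_adHV: "maps.subspace (adHV \<Gamma>)"
  unfolding adHV_def
proof (rule maps.subspaceI)
  show "0 \<in> ad \<Gamma> ` HV \<Gamma>" using ad_zero by (intro image_eqI[of _ _ 0]) (simp_all only: HV_zero)
next
  fix x y assume "x \<in> ad \<Gamma> ` HV \<Gamma>" "y \<in> ad \<Gamma> ` HV \<Gamma>"
  then show "x + y \<in> ad \<Gamma> ` HV \<Gamma>" by (elim imageE) (simp only: HV_add imageI flip: ad_add)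
next
  fix c x assume "x \<in> ad \<Gamma> ` HV \<Gamma>"
  then show "map_scale c x \<in> ad \<Gamma> ` HV \<Gamma>" by (elim imageE) (simp only: HV_scale imageI flip: ad_scale)
qed

lemma subspace_Dphi: "maps.subspace (Dphi \<Gamma> ` Hom_Z \<Gamma>)"
proof (rule maps.subspaceI)
  have eq: "D = D'" if "D \<in> Der \<Gamma>" "D' \<in> Der \<Gamma>"
    "\<And>\<alpha> i. \<alpha> \<in> \<Gamma> \<Longrightarrow> D (L \<alpha> i) = D' (L \<alpha> i) \<and> D (H \<alpha> i) = D' (H \<alpha> i)" for D D'
    using that by (intro Der_eqI) auto
  have "0 \<in> Hom_Z \<Gamma>" by (simp add: Hom_Z_def)
  moreover from this have "0 = Dphi \<Gamma> 0"
    by (intro eq Dphi_mem maps.subspace_0[OF subspace_Der]) auto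
  ultimately show "0 \<in> Dphi \<Gamma> ` Hom_Z \<Gamma>" by blast
  show "x + y \<in> Dphi \<Gamma> ` Hom_Z \<Gamma>" if "x \<in> Dphi \<Gamma> ` Hom_Z \<Gamma>" "y \<in> Dphi \<Gamma> ` Hom_Z \<Gamma>" for x y
  proof -
    obtain \<phi> \<psi> where *: "\<phi> \<in> Hom_Z \<Gamma>" "\<psi> \<in> Hom_Z \<Gamma>" and xy: "x = Dphi \<Gamma> \<phi>" "y = Dphi \<Gamma> \<psi>"
      using \<open>x \<in> _\<close> \<open>y \<in> _\<close> by blast
    have "\<phi> + \<psi> \<in> Hom_Z \<Gamma>" using * by (simp add: Hom_Z_def)
    moreover from this have "x + y = Dphi \<Gamma> (\<phi> + \<psi>)"
      unfolding xy using * by (intro eq Dphi_mem Der_memI) (auto simp: hv.scale_left_distrib)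
    ultimately show ?thesis by blast
  qed
  show "map_scale c x \<in> Dphi \<Gamma> ` Hom_Z \<Gamma>" if "x \<in> Dphi \<Gamma> ` Hom_Z \<Gamma>" for c x
  proof -
    obtain \<phi> where *: "\<phi> \<in> Hom_Z \<Gamma>" and x: "x = Dphi \<Gamma> \<phi>" using \<open>x \<in> _\<close> by blast
    have "(\<lambda>\<alpha>. c * \<phi> \<alpha>) \<in> Hom_Z \<Gamma>" using * by (simp add: Hom_Z_def distrib_left)
    moreover from this have "map_scale c x = Dphi \<Gamma> (\<lambda>\<alpha>. c * \<phi> \<alpha>)"
      unfolding x using * by (intro eq Dphi_mem Der_memI) (auto simp: map_scale_def)
    ultimately show ?thesis by blast
  qed
qed

end

section \<open>Direct sums\<close>

text \<open>Injectivity follows by applying independence to the difference of two families over the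
  union of their supports; surjectivity by extending a finite family by zero.\<close>

lemma is_direct_sumI:
  assumes sub: "\<And>i. i \<in> I \<Longrightarrow> maps.subspace (W i)" and V: "maps.subspace V"
    and W: "\<And>i. i \<in> I \<Longrightarrow> W i \<subseteq> V"
    and indep: "\<And>S f i. finite S \<Longrightarrow> S \<subseteq> I \<Longrightarrow> (\<And>i. i \<in> S \<Longrightarrow> f i \<in> W i) \<Longrightarrow> sum f S = 0 \<Longrightarrow>
      i \<in> S \<Longrightarrow> f i = 0"
    and span: "\<And>v. v \<in> V \<Longrightarrow> \<exists>S f. finite S \<and> S \<subseteq> I \<and> (\<forall>i\<in>S. f i \<in> W i) \<and> v = sum f S"
  shows "is_direct_sum V I W"
proof -
  let ?F = "{f. (\<forall>i\<in>I. f i \<in> W i) \<and> (\<forall>i. i \<notin> I \<longrightarrow> f i = 0) \<and> finite {i. f i \<noteq> 0}}"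
  let ?s = "\<lambda>f. \<Sum>i\<in>{i. f i \<noteq> 0}. f i"
  have superset: "?s f = sum f S" if "finite S" "{i. f i \<noteq> 0} \<subseteq> S" for f S
    using that by (intro sum.mono_neutral_left) blast+
  have "inj_on ?s ?F"
  proof (rule inj_onI)
    fix f g assume f: "f \<in> ?F" and g: "g \<in> ?F" and eq: "?s f = ?s g"
    let ?S = "{i. f i \<noteq> 0} \<union> {i. g i \<noteq> 0}"
    have S: "finite ?S" "?S \<subseteq> I" using f g by blast+
    have "sum f ?S = sum g ?S"
      using eq superset[of ?S f] superset[of ?S g] S(1) by (metis Un_upper1 Un_upper2)
    then have sum: "(\<Sum>i\<in>?S. f i - g i) = 0" by (simp only: sum_subtractf diff_self)
    have mem: "f i - g i \<in> W i" if "i \<in> ?S" for i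
      using that f g S by (intro maps.subspace_diff sub) blast+
    have "f i = g i" for i
    proof (cases "i \<in> ?S")
      case True
      then have "f i - g i = 0" by (intro indep[of ?S "\<lambda>i. f i - g i"] S mem sum)
      then show ?thesis by (simp only: right_minus_eq)
    next
      case False
      then have "f i = 0" "g i = 0" by blast+
      then show ?thesis by (simp only:)
    qed
    then show "f = g" by (rule ext)
  qed
  moreover have "?s f \<in> V" if "f \<in> ?F" for f
  proof (rule maps.subspace_sum[OF V])
    fix i assume "i \<in> {i. f i \<noteq> 0}"
    then show "f i \<in> V" using that W by blast
  qed
  moreover have "v \<in> ?s ` ?F" if v_mem: "v \<in> V" for v
  proof -
    obtain S f where S: "finite S" "S \<subseteq> I" and f: "\<And>i. i \<in> S \<Longrightarrow> f i \<in> W i" and v: "v = sum f S"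
      using span[OF v_mem] by blast
    let ?f = "\<lambda>i. if i \<in> S then f i else 0"
    have supp: "{i. ?f i \<noteq> 0} \<subseteq> S" by (simp only: subset_iff mem_Collect_eq split: if_split) blast
    have "?f i \<in> W i" if "i \<in> I" for i
      using f maps.subspace_0[OF sub[OF that]] by (simp only: split: if_split) blast
    moreover have "?f i = 0" if "i \<notin> I" for i using that S by (simp only: split: if_split) blast
    ultimately have "?f \<in> ?F" using supp S finite_subset by blast
    moreover have "v = ?s ?f"
      unfolding superset[OF S(1) supp] v by (rule sum.cong) (simp_all only: if_True)
    ultimately show ?thesis by (intro image_eqI[where x = ?f and f = ?s])
  qed
  ultimately show ?thesis
    unfolding is_direct_sum_def bij_betw_def using sub by blast
qed

lemma is_direct_sum_list_fourI:
  assumes sub: "maps.subspace A" "maps.subspace B" "maps.subspace C" "maps.subspace D"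
    and V: "maps.subspace V" and incl: "A \<subseteq> V" "B \<subseteq> V" "C \<subseteq> V" "D \<subseteq> V"
    and indep: "\<And>a b c d. a \<in> A \<Longrightarrow> b \<in> B \<Longrightarrow> c \<in> C \<Longrightarrow> d \<in> D \<Longrightarrow> a + b + c + d = 0 \<Longrightarrow>
      a = 0 \<and> b = 0 \<and> c = 0 \<and> d = 0"
    and span: "\<And>v. v \<in> V \<Longrightarrow> \<exists>a\<in>A. \<exists>b\<in>B. \<exists>c\<in>C. \<exists>d\<in>D. v = a + b + c + d"
  shows "is_direct_sum_list V [A, B, C, D]"
proof -
  let ?W = "\<lambda>i. [A, B, C, D] ! i"
  have less4: "i = 0 \<or> i = 1 \<or> i = 2 \<or> i = 3" if "i < length [A, B, C, D]" for i
    using that by auto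
  have four: "{..<length [A, B, C, D]} = {0, 1, 2, 3}" by auto
  have sum4: "sum f {0, 1, 2, 3 :: nat} = f 0 + f 1 + f 2 + f 3" for f :: "nat \<Rightarrow> hv \<Rightarrow> hv"
    by (simp add: add.assoc)
  have W: "?W 0 = A" "?W 1 = B" "?W 2 = C" "?W 3 = D" by simp_all
  have subW: "maps.subspace (?W i)" if "i \<in> {0, 1, 2, 3}" for i using that sub by auto
  show ?thesis
    unfolding is_direct_sum_list_def four
  proof (rule is_direct_sumI)
    show "maps.subspace V" by fact
    show "maps.subspace (?W i)" if "i \<in> {0, 1, 2, 3}" for i using that by (rule subW)
    show "?W i \<subseteq> V" if "i \<in> {0, 1, 2, 3}" for i using that incl by auto
  next
    fix S f i
    assume S: "finite S" "S \<subseteq> {0, 1, 2, 3 :: nat}" and f: "\<And>i. i \<in> S \<Longrightarrow> f i \<in> ?W i"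
      and sum: "sum f S = 0" and i: "i \<in> S"
    \<comment> \<open>Extension by zero to all four indices, so that independence of quadruples
      applies.\<close>
    define g where "g i = (if i \<in> S then f i else 0)" for i
    have g: "g i \<in> ?W i" if "i \<in> {0, 1, 2, 3}" for i
      unfolding g_def using f maps.subspace_0[OF subW[OF that]] by (simp only: split: if_split) blast
    have "sum g {0, 1, 2, 3} = sum f S"
      using S by (intro sum.mono_neutral_cong_right) (simp_all add: g_def)
    then have "g 0 + g 1 + g 2 + g 3 = 0" using sum by (simp only: sum4)
    then have "g 0 = 0 \<and> g 1 = 0 \<and> g 2 = 0 \<and> g 3 = 0"
      using g[of 0] g[of 1] g[of 2] g[of 3] unfolding W by (intro indep) simp_all
    then have "g i = 0" using i S by blast
    then show "f i = 0" using i by (simp only: g_def if_True)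
  next
    fix v assume "v \<in> V"
    then obtain a b c d where abcd: "a \<in> A" "b \<in> B" "c \<in> C" "d \<in> D" "v = a + b + c + d"
      using span by blast
    let ?f = "\<lambda>i. [a, b, c, d] ! i"
    have "v = sum ?f {0, 1, 2, 3}" unfolding sum4 abcd(5) by simp
    moreover have "\<forall>i\<in>{0, 1, 2, 3}. ?f i \<in> ?W i" using abcd by simp
    ultimately show "\<exists>S f. finite S \<and> S \<subseteq> {0, 1, 2, 3} \<and> (\<forall>i\<in>S. f i \<in> ?W i) \<and> v = sum f S"
      by (intro exI[of _ "{0, 1, 2, 3}"] exI[of _ ?f]) blast
  qed
qed

section \<open>The direct sum decompositions of the derivation space\<close>

context hv_group
begin

lemma is_direct_sum_Der_deg: "is_direct_sum (Der \<Gamma>) \<Gamma> (Der_deg \<Gamma>)"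
proof (rule is_direct_sumI)
  show "\<exists>S f. finite S \<and> S \<subseteq> \<Gamma> \<and> (\<forall>\<gamma>\<in>S. f \<gamma> \<in> Der_deg \<Gamma> \<gamma>) \<and> D = sum f S"
    if "D \<in> Der \<Gamma>" for D
    using Der_homogeneous_decomp[OF that] by (metis subsetD)
qed (auto intro: subspace_Der subspace_Der_deg Der_deg_Der Der_deg_independent)

text \<open>Covers both lists, with \<open>V\<close> the whole of \<open>Der \<Gamma>\<close> or its
  degree 0 part. The outer summands lie in \<open>V\<close>, so the inner part of an element of
  \<open>V\<close> is a difference of elements of \<open>V\<close> and stays there.\<close>

lemma is_direct_sum_list_subspace:
  assumes V: "maps.subspace V" "V \<subseteq> Der \<Gamma>" "Der_deg \<Gamma> 0 \<subseteq> V"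
  shows "is_direct_sum_list V
    [adHV \<Gamma> \<inter> V, Dphi \<Gamma> ` Hom_Z \<Gamma>, maps.span {D1 \<Gamma>}, maps.span {D2 \<Gamma>}]"
proof (rule is_direct_sum_list_fourI)
  have memV: "Dphi \<Gamma> \<phi> \<in> V" "D1 \<Gamma> \<in> V" "D2 \<Gamma> \<in> V" if "\<phi> \<in> Hom_Z \<Gamma>" for \<phi>
    using Dphi_Der_deg[OF that] D1_Der_deg D2_Der_deg V(3) by blast+
  show "Dphi \<Gamma> ` Hom_Z \<Gamma> \<subseteq> V" using memV(1) by blast
  show "maps.span {D1 \<Gamma>} \<subseteq> V" "maps.span {D2 \<Gamma>} \<subseteq> V"
    using V(3) D1_Der_deg D2_Der_deg by (intro maps.span_minimal V(1); blast)+
  show "maps.subspace (adHV \<Gamma> \<inter> V)" by (rule maps.subspace_inter[OF subspace_adHV V(1)])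
  fix D assume "D \<in> V"
  then obtain z \<phi> b c where *: "z \<in> HV \<Gamma>" "\<phi> \<in> Hom_Z \<Gamma>"
    and D: "D = ad \<Gamma> z + Dphi \<Gamma> \<phi> + map_scale b (D1 \<Gamma>) + map_scale c (D2 \<Gamma>)"
    using Der_decomp V(2) by blast
  have "ad \<Gamma> z = D - Dphi \<Gamma> \<phi> - map_scale b (D1 \<Gamma>) - map_scale c (D2 \<Gamma>)"
    by (simp add: D)
  then have "ad \<Gamma> z \<in> V"
    using \<open>D \<in> V\<close> memV[OF *(2)] V(1) by (simp only: maps.subspace_diff maps.subspace_scale)
  then have "ad \<Gamma> z \<in> adHV \<Gamma> \<inter> V" using *(1) by (auto simp: adHV_def)
  then show "\<exists>a\<in>adHV \<Gamma> \<inter> V. \<exists>p\<in>Dphi \<Gamma> ` Hom_Z \<Gamma>. \<exists>q\<in>maps.span {D1 \<Gamma>}. \<exists>r\<in>maps.span {D2 \<Gamma>}.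
      D = a + p + q + r"
    using * D unfolding maps.span_singleton by blast
next
  fix a p q r
  assume "a \<in> adHV \<Gamma> \<inter> V" "p \<in> Dphi \<Gamma> ` Hom_Z \<Gamma>" "q \<in> maps.span {D1 \<Gamma>}" "r \<in> maps.span {D2 \<Gamma>}"
    and sum: "a + p + q + r = 0"
  then obtain z \<phi> b c where *: "z \<in> HV \<Gamma>" "\<phi> \<in> Hom_Z \<Gamma>"
    and eqs: "a = ad \<Gamma> z" "p = Dphi \<Gamma> \<phi>" "q = map_scale b (D1 \<Gamma>)" "r = map_scale c (D2 \<Gamma>)"
    unfolding maps.span_singleton adHV_def by blast
  note zero = Der_decomp_unique[OF * sum[unfolded eqs]]
  have "p = 0" using sum unfolding eqs zero by (simp only: maps.scale_zero_left add_0 add_0_right)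
  then show "a = 0 \<and> p = 0 \<and> q = 0 \<and> r = 0"
    unfolding eqs zero by (simp only: maps.scale_zero_left simp_thms)
qed (use V subspace_Dphi maps.subspace_span in auto)

end

theorem theorem3p1:
  fixes \<Gamma> :: "complex set"
  assumes "0 \<in> \<Gamma>"
    and "\<And>\<alpha> \<beta>. \<alpha> \<in> \<Gamma> \<Longrightarrow> \<beta> \<in> \<Gamma> \<Longrightarrow> \<alpha> + \<beta> \<in> \<Gamma>"
    and "\<And>\<alpha>. \<alpha> \<in> \<Gamma> \<Longrightarrow> - \<alpha> \<in> \<Gamma>"
    and "\<Gamma> \<noteq> {0}"
  shows "is_direct_sum (Der \<Gamma>) \<Gamma> (Der_deg \<Gamma>)
    \<and> is_direct_sum_list (Der \<Gamma>)
        [adHV \<Gamma>, Dphi \<Gamma> ` Hom_Z \<Gamma>, maps.span {D1 \<Gamma>}, maps.span {D2 \<Gamma>}]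
    \<and> (\<forall>\<gamma>\<in>\<Gamma> - {0}. Der_deg \<Gamma> \<gamma> \<subseteq> adHV \<Gamma>)
    \<and> is_direct_sum_list (Der_deg \<Gamma> 0)
        [adHV \<Gamma> \<inter> Der_deg \<Gamma> 0, Dphi \<Gamma> ` Hom_Z \<Gamma>, maps.span {D1 \<Gamma>}, maps.span {D2 \<Gamma>}]"
proof -
  interpret hv_group \<Gamma> by unfold_locales (use assms in auto)
  \<comment> \<open>Inner derivations are derivations, so the choice \<open>V = Der \<Gamma>\<close>
    gives the first list without an intersection.\<close>
  have "adHV \<Gamma> \<inter> Der \<Gamma> = adHV \<Gamma>" using ad_mem by (auto simp: adHV_def)
  then have "is_direct_sum_list (Der \<Gamma>)
      [adHV \<Gamma>, Dphi \<Gamma> ` Hom_Z \<Gamma>, maps.span {D1 \<Gamma>}, maps.span {D2 \<Gamma>}]"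
    using is_direct_sum_list_subspace[OF subspace_Der subset_refl] Der_deg_Der by (metis subsetI)
  moreover have "is_direct_sum_list (Der_deg \<Gamma> 0)
      [adHV \<Gamma> \<inter> Der_deg \<Gamma> 0, Dphi \<Gamma> ` Hom_Z \<Gamma>, maps.span {D1 \<Gamma>}, maps.span {D2 \<Gamma>}]"
    using Der_deg_Der by (intro is_direct_sum_list_subspace subspace_Der_deg) auto
  ultimately show ?thesis
    using is_direct_sum_Der_deg Der_deg_inner by blast
qed

end
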